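(* Let $V$ be an oriented Euclidean four-space, $\Lambda^2V=\Lambda^2_+V\oplus\Lambda^2_-V$ the Hodge decomposition, and $S_\pm=S(\Lambda^2_\pm V)\cong S^2$. The map $$\Phi:S_+*S_-\longrightarrow S(\Lambda^2V),\qquad [u,v,\theta]\longmapsto\cos\theta\,u+\sin\theta\,v,\quad 0\le\theta\le\tfrac{\pi}{2},$$ is an $SO(V)$-equivariant homeomorphism. Hence $S(\Lambda^2\mathbb R^4)\cong S^2*S^2\cong S^5$. Under this homeomorphism: (i) nonzero rank-two (simple) bivectors (of unit norm) form the midpoint $\theta=\frac{\pi}{4}$, $S_+\times S_-\cong S^2\times S^2$; (ii) bivectors with two equal positive singular values form the two join ends $\theta=0$ or $\theta=\frac{\pi}{2}$, $S_+\sqcup S_-\cong S^2\sqcup S^2$; (iii) bivectors with two distinct positive singular values form the two open chambers $$S^2\times S^2\times\left(0,\tfrac{\pi}{4}\right)\ \sqcup\ S^2\times S^2\times\left(\tfrac{\pi}{4},\tfrac{\pi}{2}\right).$$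
   Context: $\Lambda^2V$ carries the inner product for which $e_i\wedge e_j$ ($i<j$) is orthonormal whenever $(e_i)$ is an orthonormal basis of $V$; $S(W)$ denotes the unit sphere of a Euclidean space $W$. $\Lambda^2_\pm V$ are the $\pm1$-eigenspaces of the Hodge star on $\Lambda^2V$ (each of dimension three). The join is $X*Y=(X\times Y\times[0,\pi/2])/\!\sim$, where the $Y$ coordinate is forgotten at $\theta=0$ and the $X$ coordinate at $\theta=\pi/2$. $SO(V)$ acts on $S_+*S_-$ through its action on each factor. The singular values $r_1\ge r_2\ge0$ of a bivector $b$ are defined by a normal form $b=r_1e_1\wedge e_2+\varepsilon r_2e_3\wedge e_4$ in an oriented orthonormal basis, $\varepsilon\in\{\pm1\}$. $b$ has rank two (is simple) iff $r_1>0=r_2$. *)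

theory Defs
  imports "HOL-Analysis.Analysis"
begin

section \<open>Bivectors\<close>

text \<open>
  The exterior square of a Euclidean space \<open>V\<close> is realised as the space of alternating bilinear
  forms on \<open>V\<close>, where \<open>x \<and> y\<close> is the form
  \<open>(p, q) \<mapsto> \<langle>x, p\<rangle> \<langle>y, q\<rangle> - \<langle>x, q\<rangle> \<langle>y, p\<rangle>\<close> (the metric identifies \<open>V\<close> with its dual).
\<close>

typedef (overloaded) ('a::euclidean_space) bivector =
  "{b :: 'a \<Rightarrow> 'a \<Rightarrow> real. bilinear b \<and> (\<forall>x. b x x = 0)}"
  morphisms bivector_form Abs_bivector
  by (rule exI[of _ "\<lambda>_ _. 0"]) (simp add: bilinear_def linear_iff)

setup_lifting type_definition_bivector

lemma bilinear_iff:
  "bilinear b \<longleftrightarrow>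
    (\<forall>x y z. b (x + y) z = b x z + b y z) \<and> (\<forall>c x z. b (c *\<^sub>R x) z = c *\<^sub>R b x z) \<and>
    (\<forall>x y z. b x (y + z) = b x y + b x z) \<and> (\<forall>c x z. b x (c *\<^sub>R z) = c *\<^sub>R b x z)"
  unfolding bilinear_def linear_iff by blast

lift_definition wedge :: "'a::euclidean_space \<Rightarrow> 'a \<Rightarrow> 'a bivector" (infixl "\<and>\<^sub>V" 75) is
  "\<lambda>x y p q. (x \<bullet> p) * (y \<bullet> q) - (x \<bullet> q) * (y \<bullet> p)"
  by (auto simp: bilinear_iff algebra_simps)

text \<open>
  The factor \<open>1/2\<close> in the inner product accounts for summing over all ordered pairs of basis
  vectors instead of over \<open>i < j\<close>; see \<open>inner_wedge\<close> below.
\<close>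

instantiation bivector :: (euclidean_space) real_inner
begin

lift_definition zero_bivector :: "'a bivector" is "\<lambda>_ _. 0"
  by (auto simp: bilinear_iff)

lift_definition plus_bivector :: "'a bivector \<Rightarrow> 'a bivector \<Rightarrow> 'a bivector" is
  "\<lambda>b c p q. b p q + c p q"
  by (auto simp: bilinear_iff algebra_simps)

lift_definition minus_bivector :: "'a bivector \<Rightarrow> 'a bivector \<Rightarrow> 'a bivector" is
  "\<lambda>b c p q. b p q - c p q"
  by (auto simp: bilinear_iff algebra_simps)

lift_definition uminus_bivector :: "'a bivector \<Rightarrow> 'a bivector" is "\<lambda>b p q. - b p q"
  by (auto simp: bilinear_iff algebra_simps)

lift_definition scaleR_bivector :: "real \<Rightarrow> 'a bivector \<Rightarrow> 'a bivector" is
  "\<lambda>r b p q. r * b p q"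
  by (auto simp: bilinear_iff algebra_simps)

lift_definition inner_bivector :: "'a bivector \<Rightarrow> 'a bivector \<Rightarrow> real" is
  "\<lambda>b c. (\<Sum>i\<in>Basis. \<Sum>j\<in>Basis. b i j * c i j) / 2" .

definition norm_bivector :: "'a bivector \<Rightarrow> real" where
  "norm_bivector b = sqrt (b \<bullet> b)"

definition sgn_bivector :: "'a bivector \<Rightarrow> 'a bivector" where
  "sgn_bivector b = inverse (norm b) *\<^sub>R b"

definition dist_bivector :: "'a bivector \<Rightarrow> 'a bivector \<Rightarrow> real" where
  "dist_bivector b c = norm (b - c)"

definition uniformity_bivector :: "('a bivector \<times> 'a bivector) filter" where
  "uniformity_bivector = (INF e\<in>{0<..}. principal {(b, c). dist b c < e})"

definition open_bivector :: "'a bivector set \<Rightarrow> bool" where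
  "open_bivector U \<longleftrightarrow>
    (\<forall>b\<in>U. \<forall>\<^sub>F (b', c) in uniformity. b' = b \<longrightarrow> c \<in> U)"

instance
proof
  fix b c d :: "'a bivector" and r s :: real
  show "b + c + d = b + (c + d)" "b + c = c + b" "0 + b = b" "- b + b = 0" "b - c = b + - c"
    "r *\<^sub>R (b + c) = r *\<^sub>R b + r *\<^sub>R c" "(r + s) *\<^sub>R b = r *\<^sub>R b + s *\<^sub>R b"
    "r *\<^sub>R s *\<^sub>R b = (r * s) *\<^sub>R b" "1 *\<^sub>R b = b"
    by (transfer; simp add: algebra_simps fun_eq_iff)+
  show "b \<bullet> c = c \<bullet> b"
    by transfer (simp add: mult.commute)
  show "(b + c) \<bullet> d = b \<bullet> d + c \<bullet> d"
    by transfer (simp add: algebra_simps sum.distrib add_divide_distrib)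
  show "(r *\<^sub>R b) \<bullet> c = r * (b \<bullet> c)"
    by transfer (simp add: sum_distrib_left mult.assoc)
  show "0 \<le> b \<bullet> b"
    by transfer (simp add: sum_nonneg)
  show "b \<bullet> b = 0 \<longleftrightarrow> b = 0"
  proof (transfer, safe)
    fix f :: "'a \<Rightarrow> 'a \<Rightarrow> real"
    assume f: "bilinear f" and *: "(\<Sum>i\<in>Basis. \<Sum>j\<in>Basis. f i j * f i j) / 2 = 0"
    have z: "bilinear (\<lambda>(p::'a) (q::'a). 0::real)"
      by (simp add: bilinear_iff)
    have "f i j = 0" if "i \<in> Basis" "j \<in> Basis" for i j
      using * that by (simp add: sum_nonneg_eq_0_iff sum_nonneg)
    then show "f = (\<lambda>_ _. 0)"
      using bilinear_eq_stdbasis[OF f z] by (simp add: fun_eq_iff)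
  qed auto
qed (rule norm_bivector_def sgn_bivector_def dist_bivector_def uniformity_bivector_def
      open_bivector_def)+

end

lemma inner_wedge:
  "(x \<and>\<^sub>V y) \<bullet> (z \<and>\<^sub>V w) = (x \<bullet> z) * (y \<bullet> w) - (x \<bullet> w) * (y \<bullet> z)"
proof -
  have S: "(\<Sum>i\<in>Basis. \<Sum>j\<in>Basis. ((p \<bullet> i) * (q \<bullet> i)) * ((p' \<bullet> j) * (q' \<bullet> j))) = (p \<bullet> q) * (p' \<bullet> q')"
    for p q p' q' :: 'a
    by (simp add: euclidean_inner[of p q] euclidean_inner[of p' q'] sum_product)
  have "(x \<and>\<^sub>V y) \<bullet> (z \<and>\<^sub>V w) =
    ((\<Sum>i\<in>Basis. \<Sum>j\<in>Basis. ((x \<bullet> i) * (z \<bullet> i)) * ((y \<bullet> j) * (w \<bullet> j)))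
    - (\<Sum>i\<in>Basis. \<Sum>j\<in>Basis. ((x \<bullet> i) * (w \<bullet> i)) * ((y \<bullet> j) * (z \<bullet> j)))
    - (\<Sum>i\<in>Basis. \<Sum>j\<in>Basis. ((y \<bullet> i) * (z \<bullet> i)) * ((x \<bullet> j) * (w \<bullet> j)))
    + (\<Sum>i\<in>Basis. \<Sum>j\<in>Basis. ((y \<bullet> i) * (w \<bullet> i)) * ((x \<bullet> j) * (z \<bullet> j)))) / 2"
    by transfer (simp add: algebra_simps sum.distrib sum_subtractf)
  then show ?thesis
    unfolding S by (simp add: algebra_simps)
qed

text \<open>
  The map on bivectors induced by a linear map \<open>g\<close> (only meaningful for linear \<open>g\<close>); it is
  determined by \<open>bivector_map_wedge\<close> below.
\<close>

definition bivector_map ::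
    "('a::euclidean_space \<Rightarrow> 'b::euclidean_space) \<Rightarrow> 'a bivector \<Rightarrow> 'b bivector" where
  "bivector_map g b = Abs_bivector (\<lambda>p q. bivector_form b (adjoint g p) (adjoint g q))"

lemma bivector_form_map:
  assumes "linear g"
  shows "bivector_form (bivector_map g b) p q = bivector_form b (adjoint g p) (adjoint g q)"
proof -
  have "linear (adjoint g)"
    using assms by (rule adjoint_linear)
  then have "(\<lambda>p q. bivector_form b (adjoint g p) (adjoint g q)) \<in>
      {b. bilinear b \<and> (\<forall>x. b x x = 0)}"
    using bivector_form[of b] by (auto simp: bilinear_iff linear_iff)
  then show ?thesis
    by (simp add: bivector_map_def Abs_bivector_inverse)
qed

lemma bivector_map_wedge:
  assumes "linear g"
  shows "bivector_map g (x \<and>\<^sub>V y) = g x \<and>\<^sub>V g y"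
proof -
  have "bivector_form (bivector_map g (x \<and>\<^sub>V y)) p q = bivector_form (g x \<and>\<^sub>V g y) p q" for p q
    by (simp add: bivector_form_map[OF assms] wedge.rep_eq adjoint_works[OF assms])
  then have "bivector_form (bivector_map g (x \<and>\<^sub>V y)) = bivector_form (g x \<and>\<^sub>V g y)"
    by blast
  then show ?thesis
    by (simp only: bivector_form_inject)
qed

text \<open>
  The rank of a bivector is the rank of the associated skew operator \<open>x \<mapsto> b(x, -)\<close>,
  where the form \<open>b(x, -)\<close> is identified with a vector.
\<close>

definition bivector_rank :: "'a::euclidean_space bivector \<Rightarrow> nat" where
  "bivector_rank b = dim {y. \<exists>x. \<forall>z. y \<bullet> z = bivector_form b x z}"

definition simple_bivector :: "'a::euclidean_space bivector \<Rightarrow> bool" where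
  "simple_bivector b \<longleftrightarrow> b \<noteq> 0 \<and> (\<exists>x y. b = x \<and>\<^sub>V y)"


section \<open>Orientations and the Hodge star in dimension four\<close>

definition ordered_bases :: "('a::euclidean_space ^ 'n) set" where
  "ordered_bases =
    {e. inj (($) e) \<and> independent (range (($) e)) \<and> span (range (($) e)) = UNIV}"

definition same_orientation :: "('a::euclidean_space ^ 'n) rel" where
  "same_orientation = {(e, f). e \<in> ordered_bases \<and> f \<in> ordered_bases \<and>
    (\<exists>A :: real ^ 'n ^ 'n. det A > 0 \<and> (\<forall>j. f $ j = (\<Sum>i\<in>UNIV. A $ i $ j *\<^sub>R e $ i)))}"

definition orientations :: "('a::euclidean_space ^ 'n) set set" where
  "orientations = ordered_bases // same_orientation"

definition oriented_orthonormal_bases ::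
    "('a::euclidean_space ^ 'n) set \<Rightarrow> ('a ^ 'n) set" where
  "oriented_orthonormal_bases \<omega> = {e \<in> \<omega>. \<forall>i j. e $ i \<bullet> e $ j = (if i = j then 1 else 0)}"

definition SO :: "('a::euclidean_space ^ 'n) set \<Rightarrow> ('a \<Rightarrow> 'a) set" where
  "SO \<omega> = {g. orthogonal_transformation g \<and> (\<forall>e\<in>\<omega>. (\<chi> i. g (e $ i)) \<in> \<omega>)}"

text \<open>
  Since the even permutations of an oriented orthonormal basis are again oriented orthonormal
  bases, the condition below fixes the Hodge star on all \<open>e\<^sub>i \<and> e\<^sub>j\<close>. (In the index type \<open>4\<close>
  the numeral \<open>4\<close> denotes \<open>0\<close>, so \<open>1, 2, 3, 4\<close> are its four distinct elements.)
\<close>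

definition hodge_star ::
    "('a::euclidean_space ^ 4) set \<Rightarrow> 'a bivector \<Rightarrow> 'a bivector" where
  "hodge_star \<omega> = (THE s. linear s \<and>
    (\<forall>e\<in>oriented_orthonormal_bases \<omega>. s (e $ 1 \<and>\<^sub>V e $ 2) = e $ 3 \<and>\<^sub>V e $ 4))"

definition selfdual :: "('a::euclidean_space ^ 4) set \<Rightarrow> 'a bivector set" where
  "selfdual \<omega> = {b. hodge_star \<omega> b = b}"

definition antiselfdual :: "('a::euclidean_space ^ 4) set \<Rightarrow> 'a bivector set" where
  "antiselfdual \<omega> = {b. hodge_star \<omega> b = - b}"

definition S_plus :: "('a::euclidean_space ^ 4) set \<Rightarrow> 'a bivector set" where
  "S_plus \<omega> = sphere 0 1 \<inter> selfdual \<omega>"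

definition S_minus :: "('a::euclidean_space ^ 4) set \<Rightarrow> 'a bivector set" where
  "S_minus \<omega> = sphere 0 1 \<inter> antiselfdual \<omega>"

definition singular_values ::
    "('a::euclidean_space ^ 4) set \<Rightarrow> 'a bivector \<Rightarrow> real \<Rightarrow> real \<Rightarrow> bool" where
  "singular_values \<omega> b r\<^sub>1 r\<^sub>2 \<longleftrightarrow> r\<^sub>1 \<ge> r\<^sub>2 \<and> r\<^sub>2 \<ge> 0 \<and>
    (\<exists>e\<in>oriented_orthonormal_bases \<omega>. \<exists>\<epsilon>\<in>{1, -1}.
      b = r\<^sub>1 *\<^sub>R (e $ 1 \<and>\<^sub>V e $ 2) + (\<epsilon> * r\<^sub>2) *\<^sub>R (e $ 3 \<and>\<^sub>V e $ 4))"


section \<open>Joins\<close>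

definition quotient_topology :: "'a topology \<Rightarrow> 'a rel \<Rightarrow> 'a set topology" where
  "quotient_topology X r = topology (\<lambda>U. U \<subseteq> topspace X // r \<and> openin X (\<Union>U))"

lemma openin_quotient_topology:
  assumes r: "equiv (topspace X) r"
  shows "openin (quotient_topology X r) U \<longleftrightarrow> U \<subseteq> topspace X // r \<and> openin X (\<Union>U)"
proof -
  have "istopology (\<lambda>U. U \<subseteq> topspace X // r \<and> openin X (\<Union>U))"
    unfolding istopology_def
  proof (rule conjI; intro allI impI)
    fix U V
    assume U: "U \<subseteq> topspace X // r \<and> openin X (\<Union>U)" and V: "V \<subseteq> topspace X // r \<and> openin X (\<Union>V)"
    have "\<Union>(U \<inter> V) = \<Union>U \<inter> \<Union>V"
    proof
      show "\<Union>U \<inter> \<Union>V \<subseteq> \<Union>(U \<inter> V)"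
      proof
        fix x
        assume "x \<in> \<Union>U \<inter> \<Union>V"
        then obtain C D where "C \<in> U" "D \<in> V" "x \<in> C" "x \<in> D"
          by blast
        with U V quotient_disj[OF r, of C D] show "x \<in> \<Union>(U \<inter> V)"
          by blast
      qed
    qed blast
    with U V show "U \<inter> V \<subseteq> topspace X // r \<and> openin X (\<Union>(U \<inter> V))"
      by auto
  next
    fix K
    assume K: "\<forall>U\<in>K. U \<subseteq> topspace X // r \<and> openin X (\<Union>U)"
    have "\<Union>(\<Union>K) = (\<Union>U\<in>K. \<Union>U)"
      by blast
    with K show "\<Union>K \<subseteq> topspace X // r \<and> openin X (\<Union>(\<Union>K))"
      by auto
  qed
  then show ?thesis
    by (simp add: quotient_topology_def)
qed

definition join_cylinder :: "'a topology \<Rightarrow> 'b topology \<Rightarrow> ('a \<times> 'b \<times> real) topology" where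
  "join_cylinder X Y = prod_topology X (prod_topology Y (top_of_set {0..pi / 2}))"

definition join_rel :: "'a topology \<Rightarrow> 'b topology \<Rightarrow> ('a \<times> 'b \<times> real) rel" where
  "join_rel X Y = {((x, y, \<theta>), (x', y', \<theta>')).
    (x, y, \<theta>) \<in> topspace (join_cylinder X Y) \<and> (x', y', \<theta>') \<in> topspace (join_cylinder X Y) \<and>
    \<theta> = \<theta>' \<and> (x = x' \<or> \<theta> = pi / 2) \<and> (y = y' \<or> \<theta> = 0)}"

lemma equiv_join_rel: "equiv (topspace (join_cylinder X Y)) (join_rel X Y)"
  unfolding equiv_def refl_on_def sym_def trans_def join_rel_def by auto

definition join_topology ::
    "'a topology \<Rightarrow> 'b topology \<Rightarrow> ('a \<times> 'b \<times> real) set topology" where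
  "join_topology X Y = quotient_topology (join_cylinder X Y) (join_rel X Y)"

definition join_class ::
    "'a topology \<Rightarrow> 'b topology \<Rightarrow> 'a \<times> 'b \<times> real \<Rightarrow> ('a \<times> 'b \<times> real) set" where
  "join_class X Y p = join_rel X Y `` {p}"

definition join_part ::
    "'a topology \<Rightarrow> 'b topology \<Rightarrow> real set \<Rightarrow> ('a \<times> 'b \<times> real) set set" where
  "join_part X Y T = join_class X Y ` (topspace X \<times> topspace Y \<times> T)"

text \<open>
  The map \<open>[x, y, \<theta>] \<mapsto> [f x, g y, \<theta>]\<close> into the join of \<open>X'\<close> and \<open>Y'\<close>: the image of a
  class is saturated with respect to the relation of the target.
\<close>

definition join_map ::
    "'c topology \<Rightarrow> 'd topology \<Rightarrow> ('a \<Rightarrow> 'c) \<Rightarrow> ('b \<Rightarrow> 'd) \<Rightarrow>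
      ('a \<times> 'b \<times> real) set \<Rightarrow> ('c \<times> 'd \<times> real) set" where
  "join_map X' Y' f g C = join_rel X' Y' `` ((\<lambda>(x, y, \<theta>). (f x, g y, \<theta>)) ` C)"


section \<open>The join of the two Hodge spheres\<close>

abbreviation T_plus :: "('a::euclidean_space ^ 4) set \<Rightarrow> 'a bivector topology" where
  "T_plus \<omega> \<equiv> top_of_set (S_plus \<omega>)"

abbreviation T_minus :: "('a::euclidean_space ^ 4) set \<Rightarrow> 'a bivector topology" where
  "T_minus \<omega> \<equiv> top_of_set (S_minus \<omega>)"

abbreviation hodge_join ::
    "('a::euclidean_space ^ 4) set \<Rightarrow> ('a bivector \<times> 'a bivector \<times> real) set topology" where
  "hodge_join \<omega> \<equiv> join_topology (T_plus \<omega>) (T_minus \<omega>)"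

abbreviation hodge_class ::
    "('a::euclidean_space ^ 4) set \<Rightarrow> 'a bivector \<times> 'a bivector \<times> real \<Rightarrow>
      ('a bivector \<times> 'a bivector \<times> real) set" where
  "hodge_class \<omega> \<equiv> join_class (T_plus \<omega>) (T_minus \<omega>)"

abbreviation hodge_part ::
    "('a::euclidean_space ^ 4) set \<Rightarrow> real set \<Rightarrow> ('a bivector \<times> 'a bivector \<times> real) set set" where
  "hodge_part \<omega> \<equiv> join_part (T_plus \<omega>) (T_minus \<omega>)"

abbreviation SO_join_action ::
    "('a::euclidean_space ^ 4) set \<Rightarrow> ('a \<Rightarrow> 'a) \<Rightarrow>
      ('a bivector \<times> 'a bivector \<times> real) set \<Rightarrow> ('a bivector \<times> 'a bivector \<times> real) set" where
  "SO_join_action \<omega> g \<equiv>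
    join_map (T_plus \<omega>) (T_minus \<omega>) (bivector_map g) (bivector_map g)"

text \<open>
  The map \<open>[u, v, \<theta>] \<mapsto> cos \<theta> u + sin \<theta> v\<close>: the common value of the formula on all
  representatives of a class.
\<close>

definition \<Phi> ::
    "('a::euclidean_space bivector \<times> 'a bivector \<times> real) set \<Rightarrow> 'a bivector" where
  "\<Phi> C = the_elem ((\<lambda>(u, v, \<theta>). cos \<theta> *\<^sub>R u + sin \<theta> *\<^sub>R v) ` C)"

abbreviation S2 :: "(real ^ 3) topology" where
  "S2 \<equiv> top_of_set (sphere 0 1)"

abbreviation S5 :: "(real ^ 6) topology" where
  "S5 \<equiv> top_of_set (sphere 0 1)"

end

theory Submission
  imports Defs
begin

text \<open>
  The Hodge star is a selfadjoint isometric involution of \<open>\<Lambda>\<^sup>2V\<close>, so \<open>\<Lambda>\<^sup>2V\<close> is the orthogonal sum of two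
  eigenspaces, and the unit sphere of an orthogonal sum is the join of the unit spheres of the
  summands: the angle \<open>\<theta>\<close> records the norms of the two components and the join forgets a direction
  exactly where the component vanishes (\<open>homeomorphic_map_join_orthogonal_spheres\<close>). The map is a
  homeomorphism because the join of compact spaces is compact. The same lemma, applied to
  \<open>\<real>\<^sup>3 \<oplus> \<real>\<^sup>3\<close>, identifies \<open>S\<^sup>2 * S\<^sup>2\<close> with \<open>S\<^sup>5\<close>. Equivariance holds because \<open>SO(V)\<close> commutes with the star.

  The star itself is written down in one oriented orthonormal frame. It does not depend on the frame
  because \<open>\<star>(e\<^sub>1 \<and> e\<^sub>2)\<close> and \<open>e\<^sub>3 \<and> e\<^sub>4\<close> are unit vectors whose inner product is the determinant of the
  change of frame (\<open>frame_star_oriented\<close>).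

  The classification by singular values rests on \<open>hodge_pair_frame\<close>: for \<open>u \<in> S\<^sub>+\<close> and \<open>v \<in> S\<^sub>-\<close> there is
  one oriented orthonormal frame with \<open>u = (e\<^sub>1 \<and> e\<^sub>2 + e\<^sub>3 \<and> e\<^sub>4) / \<surd>2\<close> and
  \<open>v = (e\<^sub>1 \<and> e\<^sub>2 - e\<^sub>3 \<and> e\<^sub>4) / \<surd>2\<close>. In this frame \<open>cos \<theta> u + sin \<theta> v\<close> is in normal form, with singular
  values \<open>(cos \<theta> + sin \<theta>) / \<surd>2\<close> and \<open>\<bar>cos \<theta> - sin \<theta>\<bar> / \<surd>2\<close>, and the three strata can be read off: the
  second value vanishes at \<open>\<pi> / 4\<close>, the two agree where \<open>cos \<theta>\<close> or \<open>sin \<theta>\<close> vanishes, and they are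
  distinct and positive elsewhere. The topology of the strata comes from the quotient map of the
  join, which restricts to the parts cut out by conditions on \<open>\<theta>\<close> since these are saturated
  (\<open>homeomorphic_map_join_part\<close>).
\<close>

section \<open>Quotients and joins\<close>

lemma quotient_map_quotient_topology:
  assumes r: "equiv (topspace X) r"
  shows "quotient_map X (quotient_topology X r) (\<lambda>x. r `` {x})"
proof -
  have top: "topspace (quotient_topology X r) = topspace X // r"
  proof
    have "openin (quotient_topology X r) (topspace X // r)"
      using r by (simp add: openin_quotient_topology Union_quotient)
    then show "topspace X // r \<subseteq> topspace (quotient_topology X r)"
      by (rule openin_subset)
    show "topspace (quotient_topology X r) \<subseteq> topspace X // r"
      using openin_topspace[of "quotient_topology X r"] by (simp only: openin_quotient_topology[OF r])
  qed
  have "{x \<in> topspace X. r `` {x} \<in> U} = \<Union>U" if "U \<subseteq> topspace X // r" for U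
  proof
    show "{x \<in> topspace X. r `` {x} \<in> U} \<subseteq> \<Union>U"
      using equiv_class_self[OF r] by blast
    show "\<Union>U \<subseteq> {x \<in> topspace X. r `` {x} \<in> U}"
    proof
      fix x assume "x \<in> \<Union>U"
      then obtain C where C: "C \<in> U" "x \<in> C" by blast
      with that obtain y where y: "y \<in> topspace X" "C = r `` {y}"
        by (meson quotientE subsetD)
      with C r have "r `` {x} = C"
        by (metis Image_singleton_iff equiv_class_eq)
      moreover have "x \<in> topspace X"
        using C y r by (auto simp: equiv_def refl_on_def)
      ultimately show "x \<in> {x \<in> topspace X. r `` {x} \<in> U}"
        using C by simp
    qed
  qed
  then show ?thesis
    unfolding quotient_map_def top by (auto simp: openin_quotient_topology[OF r] quotient_def)
qed

lemma topspace_join_cylinder [simp]: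
  "topspace (join_cylinder X Y) = topspace X \<times> topspace Y \<times> {0..pi / 2}"
  by (simp add: join_cylinder_def)

lemma quotient_map_join_class:
  "quotient_map (join_cylinder X Y) (join_topology X Y) (join_class X Y)"
  using quotient_map_quotient_topology[OF equiv_join_rel]
  by (simp add: join_topology_def join_class_def[abs_def])

lemma join_class_eq_iff:
  assumes "p \<in> topspace (join_cylinder X Y)" "q \<in> topspace (join_cylinder X Y)"
  shows "join_class X Y p = join_class X Y q \<longleftrightarrow> (p, q) \<in> join_rel X Y"
  using eq_equiv_class_iff[OF equiv_join_rel assms] by (simp add: join_class_def)

lemma topspace_join_topology:
  "topspace (join_topology X Y) = join_class X Y ` (topspace X \<times> topspace Y \<times> {0..pi / 2})"
  using quotient_imp_surjective_map[OF quotient_map_join_class[of X Y]] by simp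

text \<open>
  The coordinate \<open>\<theta>\<close> is constant on classes, so every part of the join cut out by a condition on
  \<open>\<theta>\<close> is saturated; this is what lets topological properties pass between cylinder and join.
\<close>

lemma join_class_in_part_iff:
  assumes "x \<in> topspace X" "y \<in> topspace Y" "\<theta> \<in> {0..pi / 2}" "T \<subseteq> {0..pi / 2}"
  shows "join_class X Y (x, y, \<theta>) \<in> join_part X Y T \<longleftrightarrow> \<theta> \<in> T"
proof
  assume "join_class X Y (x, y, \<theta>) \<in> join_part X Y T"
  then obtain x' y' \<theta>' where *: "x' \<in> topspace X" "y' \<in> topspace Y" "\<theta>' \<in> T"
    "join_class X Y (x, y, \<theta>) = join_class X Y (x', y', \<theta>')"
    by (auto simp: join_part_def)
  with assms have "((x, y, \<theta>), (x', y', \<theta>')) \<in> join_rel X Y"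
    by (subst join_class_eq_iff[symmetric]) auto
  with * show "\<theta> \<in> T"
    by (simp add: join_rel_def)
qed (use assms in \<open>auto simp: join_part_def\<close>)

lemma preimage_join_part:
  assumes "T \<subseteq> {0..pi / 2}"
  shows "{p \<in> topspace (join_cylinder X Y). join_class X Y p \<in> join_part X Y T} =
    topspace X \<times> topspace Y \<times> T"
  using assms by (auto simp: join_class_in_part_iff) (auto simp: join_part_def)

lemma join_part_subset: "T \<subseteq> {0..pi / 2} \<Longrightarrow> join_part X Y T \<subseteq> topspace (join_topology X Y)"
  by (auto simp: join_part_def topspace_join_topology)

lemma openin_join_part:
  assumes "openin (top_of_set {0..pi / 2}) T"
  shows "openin (join_topology X Y) (join_part X Y T)"
proof -
  have T: "T \<subseteq> {0..pi / 2}"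
    using openin_subset[OF assms] by simp
  have "openin (join_cylinder X Y) (topspace X \<times> topspace Y \<times> T)"
    unfolding join_cylinder_def using assms by (simp add: openin_prod_Times_iff)
  then show ?thesis
    using quotient_map_join_class[of X Y] join_part_subset[OF T, of X Y]
    unfolding quotient_map_def preimage_join_part[OF T, symmetric] by simp
qed

lemma closedin_join_part:
  assumes "closedin (top_of_set {0..pi / 2}) T"
  shows "closedin (join_topology X Y) (join_part X Y T)"
proof -
  have T: "T \<subseteq> {0..pi / 2}"
    using closedin_subset[OF assms] by simp
  have "closedin (join_cylinder X Y) (topspace X \<times> topspace Y \<times> T)"
    unfolding join_cylinder_def using assms by (simp add: closedin_prod_Times_iff)
  then show ?thesis
    using quotient_map_join_class[of X Y] join_part_subset[OF T, of X Y]
    unfolding quotient_map_closedin preimage_join_part[OF T, symmetric] by simp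
qed

text \<open>
  Away from the two ends nothing is identified, and an injective quotient map is a homeomorphism;
  quotient maps restrict to saturated subsets as soon as these are open or closed.
\<close>

lemma homeomorphic_map_join_part:
  assumes T: "openin (top_of_set {0..pi / 2}) T \<or> closedin (top_of_set {0..pi / 2}) T"
    and inner: "T \<subseteq> {0<..<pi / 2}"
  shows "homeomorphic_map (prod_topology X (prod_topology Y (top_of_set T)))
    (subtopology (join_topology X Y) (join_part X Y T)) (join_class X Y)"
proof -
  have T': "T \<subseteq> {0..pi / 2}"
    using inner by force
  have "subtopology (join_cylinder X Y) (topspace X \<times> topspace Y \<times> T) =
      prod_topology X (prod_topology Y (top_of_set T))"
    using T' by (simp add: join_cylinder_def prod_topology_subtopology subtopology_subtopology
        Times_Int_Times inf.absorb2 flip: subtopology_Times)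
  moreover have "quotient_map (subtopology (join_cylinder X Y) (topspace X \<times> topspace Y \<times> T))
      (subtopology (join_topology X Y) (join_part X Y T)) (join_class X Y)"
    using T openin_join_part closedin_join_part
    by (intro quotient_map_restriction[OF quotient_map_join_class preimage_join_part[OF T']]) blast
  moreover have "inj_on (join_class X Y) (topspace X \<times> topspace Y \<times> T)"
  proof
    fix p q assume pq: "p \<in> topspace X \<times> topspace Y \<times> T" "q \<in> topspace X \<times> topspace Y \<times> T"
      "join_class X Y p = join_class X Y q"
    then have "(p, q) \<in> join_rel X Y"
      using T' by (subst join_class_eq_iff[symmetric]) auto
    with pq inner show "p = q"
      by (auto simp: join_rel_def)
  qed
  ultimately show ?thesis
    by (simp add: homeomorphic_map_def)
qed

lemma join_map_class:
  assumes f: "f \<in> topspace X \<rightarrow> topspace X'" and g: "g \<in> topspace Y \<rightarrow> topspace Y'"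
    and p: "x \<in> topspace X" "y \<in> topspace Y" "\<theta> \<in> {0..pi / 2}"
  shows "join_map X' Y' f g (join_class X Y (x, y, \<theta>)) = join_class X' Y' (f x, g y, \<theta>)"
proof -
  let ?h = "\<lambda>(x, y, \<theta>). (f x, g y, \<theta> :: real)"
  have "q \<in> join_class X Y (x, y, \<theta>) \<Longrightarrow> (?h (x, y, \<theta>), ?h q) \<in> join_rel X' Y'" for q
    using f g by (auto simp: join_class_def join_rel_def)
  then have "join_rel X' Y' `` {?h q} = join_rel X' Y' `` {?h (x, y, \<theta>)}"
    if "q \<in> join_class X Y (x, y, \<theta>)" for q
    using that equiv_class_eq[OF equiv_join_rel] by metis
  moreover have "(x, y, \<theta>) \<in> join_class X Y (x, y, \<theta>)"
    using p by (auto simp: join_class_def join_rel_def)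
  ultimately show ?thesis
    unfolding join_map_def Image_eq_UN[of _ "_ ` _"] join_class_def[of X' Y'] by auto
qed

lemma join_part_Int:
  assumes "S \<subseteq> {0..pi / 2}" "T \<subseteq> {0..pi / 2}"
  shows "join_part X Y (S \<inter> T) = join_part X Y S \<inter> join_part X Y T"
proof (intro equalityI subsetI)
  fix C assume C: "C \<in> join_part X Y S \<inter> join_part X Y T"
  then obtain x y \<theta> where *: "x \<in> topspace X" "y \<in> topspace Y" "\<theta> \<in> S" "C = join_class X Y (x, y, \<theta>)"
    by (auto simp: join_part_def)
  with C assms have "\<theta> \<in> T"
    using join_class_in_part_iff[of x X y Y \<theta> T] by auto
  with * show "C \<in> join_part X Y (S \<inter> T)"
    by (auto simp: join_part_def)
qed (auto simp: join_part_def)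

lemma join_part_Un: "join_part X Y (S \<union> T) = join_part X Y S \<union> join_part X Y T"
  by (auto simp: join_part_def)

lemma openin_join_part_within:
  assumes S: "openin (top_of_set T) S" and T: "T \<subseteq> {0..pi / 2}"
  shows "openin (subtopology (join_topology X Y) (join_part X Y T)) (join_part X Y S)"
proof -
  obtain U where U: "open U" "S = T \<inter> U"
    using S by (auto simp: openin_open)
  then have "S = T \<inter> ({0..pi / 2} \<inter> U)"
    using T by auto
  then have "join_part X Y S = join_part X Y T \<inter> join_part X Y ({0..pi / 2} \<inter> U)"
    using T by (metis join_part_Int inf_le1)
  moreover have "openin (join_topology X Y) (join_part X Y ({0..pi / 2} \<inter> U))"
    using U by (intro openin_join_part) (auto simp: openin_open)
  ultimately show ?thesis
    by (simp add: openin_subtopology_Int2)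
qed

text \<open>
  At an end of the join only one coordinate survives, and the forgotten one may be frozen at any
  value; the resulting map is bijective onto the end, and compactness of the surviving factor makes
  its inverse continuous.
\<close>

lemma homeomorphic_map_join_ends:
  assumes H: "Hausdorff_space (join_topology X Y)"
  shows "compact_space X \<Longrightarrow> y \<in> topspace Y \<Longrightarrow> homeomorphic_map X
      (subtopology (join_topology X Y) (join_part X Y {0})) (\<lambda>x. join_class X Y (x, y, 0))"
    and "compact_space Y \<Longrightarrow> x \<in> topspace X \<Longrightarrow> homeomorphic_map Y
      (subtopology (join_topology X Y) (join_part X Y {pi / 2})) (\<lambda>y. join_class X Y (x, y, pi / 2))"
proof -
  have I: "{0} \<subseteq> {0..pi / 2}" "{pi / 2} \<subseteq> {0..pi / 2}" by auto
  have cont: "continuous_map Z (join_topology X Y) (\<lambda>z. join_class X Y (h z))"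
    if "continuous_map Z (join_cylinder X Y) h" for Z :: "'z topology" and h
    using continuous_map_compose[OF that quotient_imp_continuous_map[OF quotient_map_join_class]]
    by (simp add: o_def)
  show "homeomorphic_map X (subtopology (join_topology X Y) (join_part X Y {0}))
      (\<lambda>x. join_class X Y (x, y, 0))" if "compact_space X" and y: "y \<in> topspace Y"
  proof (rule continuous_imp_homeomorphic_map[OF _ that(1)])
    have "continuous_map X (join_cylinder X Y) (\<lambda>x. (x, y, 0))"
      using y by (simp add: join_cylinder_def continuous_map_pairwise o_def)
    from cont[OF this] show "continuous_map X (subtopology (join_topology X Y) (join_part X Y {0}))
        (\<lambda>x. join_class X Y (x, y, 0))"
      using y by (auto simp: continuous_map_in_subtopology join_part_def)
    have end_class: "join_class X Y (x, y', 0) = join_class X Y (x, y, 0)"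
      if "x \<in> topspace X" "y' \<in> topspace Y" for x y'
      using that y by (subst join_class_eq_iff) (auto simp: join_rel_def)
    have "join_part X Y {0} = (\<lambda>x. join_class X Y (x, y, 0)) ` topspace X"
    proof (intro equalityI subsetI)
      fix C assume "C \<in> join_part X Y {0}"
      then obtain x y' where "x \<in> topspace X" "y' \<in> topspace Y" "C = join_class X Y (x, y', 0)"
        by (auto simp: join_part_def)
      with end_class[of x y'] show "C \<in> (\<lambda>x. join_class X Y (x, y, 0)) ` topspace X"
        by blast
    qed (use y in \<open>auto simp: join_part_def\<close>)
    then show "(\<lambda>x. join_class X Y (x, y, 0)) ` topspace X =
        topspace (subtopology (join_topology X Y) (join_part X Y {0}))"
      using join_part_subset[OF I(1), of X Y] by auto
    show "inj_on (\<lambda>x. join_class X Y (x, y, 0)) (topspace X)"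
      using y by (auto simp: inj_on_def join_class_eq_iff join_rel_def)
  qed (rule Hausdorff_space_subtopology[OF H])
  show "homeomorphic_map Y (subtopology (join_topology X Y) (join_part X Y {pi / 2}))
      (\<lambda>y. join_class X Y (x, y, pi / 2))" if "compact_space Y" and x: "x \<in> topspace X"
  proof (rule continuous_imp_homeomorphic_map[OF _ that(1)])
    have "continuous_map Y (join_cylinder X Y) (\<lambda>y. (x, y, pi / 2))"
      using x by (simp add: join_cylinder_def continuous_map_pairwise o_def)
    from cont[OF this] show "continuous_map Y (subtopology (join_topology X Y) (join_part X Y {pi / 2}))
        (\<lambda>y. join_class X Y (x, y, pi / 2))"
      using x by (auto simp: continuous_map_in_subtopology join_part_def)
    have end_class: "join_class X Y (x', y, pi / 2) = join_class X Y (x, y, pi / 2)"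
      if "x' \<in> topspace X" "y \<in> topspace Y" for x' y
      using that x by (subst join_class_eq_iff) (auto simp: join_rel_def)
    have "join_part X Y {pi / 2} = (\<lambda>y. join_class X Y (x, y, pi / 2)) ` topspace Y"
    proof (intro equalityI subsetI)
      fix C assume "C \<in> join_part X Y {pi / 2}"
      then obtain x' y where "x' \<in> topspace X" "y \<in> topspace Y" "C = join_class X Y (x', y, pi / 2)"
        by (auto simp: join_part_def)
      with end_class[of x' y] show "C \<in> (\<lambda>y. join_class X Y (x, y, pi / 2)) ` topspace Y"
        by blast
    qed (use x in \<open>auto simp: join_part_def\<close>)
    then show "(\<lambda>y. join_class X Y (x, y, pi / 2)) ` topspace Y =
        topspace (subtopology (join_topology X Y) (join_part X Y {pi / 2}))"
      using join_part_subset[OF I(2), of X Y] by auto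
    show "inj_on (\<lambda>y. join_class X Y (x, y, pi / 2)) (topspace Y)"
      using x by (auto simp: inj_on_def join_class_eq_iff join_rel_def)
  qed (rule Hausdorff_space_subtopology[OF H])
qed

section \<open>Disjoint unions\<close>

text \<open>
  Because every piece is open in the union, a subset of the union is open as soon as its trace on
  each piece is; this is the defining property of the topology of a disjoint union.
\<close>

lemma homeomorphic_map_sum_topology:
  assumes f: "\<And>i. i \<in> I \<Longrightarrow> homeomorphic_map (X i) (subtopology Z (A i)) (f i)"
    and A: "\<And>i. i \<in> I \<Longrightarrow> openin (subtopology Z (\<Union>i\<in>I. A i)) (A i)"
    and disj: "disjoint_family_on A I"
  shows "homeomorphic_map (sum_topology X I) (subtopology Z (\<Union>i\<in>I. A i)) (\<lambda>(i, x). f i x)"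
proof -
  let ?U = "\<Union>i\<in>I. A i"
  have sub: "A i \<subseteq> topspace Z" if "i \<in> I" for i
    using openin_subset[OF A[OF that]] by auto
  have im: "f i ` topspace (X i) = A i" if "i \<in> I" for i
    using homeomorphic_imp_surjective_map[OF f[OF that]] sub[OF that] by auto
  have op: "openin (subtopology Z ?U) (f i ` V)" if "i \<in> I" "openin (X i) V" for i V
  proof -
    have "openin (subtopology Z (A i)) (f i ` V)"
      using f[OF that(1)] that(2) homeomorphic_imp_open_map open_map_def by blast
    moreover have "subtopology Z (A i) = subtopology (subtopology Z ?U) (A i)"
      using that(1) by (simp add: subtopology_subtopology) (metis Int_absorb1 UN_upper)
    ultimately show ?thesis
      using A[OF that(1)] openin_trans_full by metis
  qed
  show ?thesis
  proof (rule bijective_open_imp_homeomorphic_map)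
    show "continuous_map (sum_topology X I) (subtopology Z ?U) (\<lambda>(i, x). f i x)"
    proof (unfold continuous_map_def, intro conjI allI impI)
      show "(\<lambda>(i, x). f i x) \<in> topspace (sum_topology X I) \<rightarrow> topspace (subtopology Z ?U)"
        using im sub by fastforce
      fix W assume W: "openin (subtopology Z ?U) W"
      show "openin (sum_topology X I)
          {p \<in> topspace (sum_topology X I). (case p of (i, x) \<Rightarrow> f i x) \<in> W}"
      proof (unfold openin_sum_topology, intro conjI ballI)
        fix i assume i: "i \<in> I"
        have "openin (subtopology Z (A i)) (A i \<inter> W)"
        proof -
          have "openin (subtopology (subtopology Z ?U) (A i)) (A i \<inter> W)"
            using W by (rule openin_subtopology_Int2)
          moreover have "subtopology Z (A i) = subtopology (subtopology Z ?U) (A i)"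
            using i by (simp add: subtopology_subtopology) (metis Int_absorb1 UN_upper)
          ultimately show ?thesis by simp
        qed
        then have "openin (X i) {x \<in> topspace (X i). f i x \<in> A i \<inter> W}"
          using homeomorphic_imp_continuous_map[OF f[OF i]] unfolding continuous_map_def by blast
        moreover have "{x. (i, x) \<in> {p \<in> topspace (sum_topology X I). (case p of (i, x) \<Rightarrow> f i x) \<in> W}}
            = {x \<in> topspace (X i). f i x \<in> A i \<inter> W}"
          using i im[OF i] by auto
        ultimately show "openin (X i)
          {x. (i, x) \<in> {p \<in> topspace (sum_topology X I). (case p of (i, x) \<Rightarrow> f i x) \<in> W}}"
          by simp
      qed auto
    qed
    show "open_map (sum_topology X I) (subtopology Z ?U) (\<lambda>(i, x). f i x)"
    proof (unfold open_map_def, intro allI impI)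
      fix W assume W: "openin (sum_topology X I) W"
      have "(\<lambda>(i, x). f i x) ` W = (\<Union>i\<in>I. f i ` {x. (i, x) \<in> W})"
        using W by (force simp: openin_sum_topology image_iff)
      moreover have "openin (subtopology Z ?U) (\<Union>i\<in>I. f i ` {x. (i, x) \<in> W})"
        using W op by (intro openin_Union) (auto simp: openin_sum_topology)
      ultimately show "openin (subtopology Z ?U) ((\<lambda>(i, x). f i x) ` W)"
        by simp
    qed
    show "(\<lambda>(i, x). f i x) ` topspace (sum_topology X I) = topspace (subtopology Z ?U)"
    proof -
      have "(\<lambda>(i, x). f i x) ` topspace (sum_topology X I) = (\<Union>i\<in>I. f i ` topspace (X i))"
        by (force simp: image_iff)
      also have "\<dots> = ?U"
        using im by (intro SUP_cong) auto
      also have "\<dots> = topspace (subtopology Z ?U)"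
        using sub by auto
      finally show ?thesis .
    qed
    show "inj_on (\<lambda>(i, x). f i x) (topspace (sum_topology X I))"
    proof (rule inj_onI, clarsimp)
      fix i x j y
      assume *: "i \<in> I" "x \<in> topspace (X i)" "j \<in> I" "y \<in> topspace (X j)" "f i x = f j y"
      then have "f i x \<in> A i" "f i x \<in> A j"
        using im by blast+
      with * disj have "i = j"
        by (auto simp: disjoint_family_on_def)
      moreover from this * have "x = y"
        using homeomorphic_imp_injective_map[OF f] by (metis inj_onD)
      ultimately show "i = j \<and> x = y" ..
    qed
  qed
qed

lemma homeomorphic_space_sum_topology:
  assumes "\<And>i. i \<in> I \<Longrightarrow> X i homeomorphic_space Y i"
  shows "sum_topology X I homeomorphic_space sum_topology Y I"
proof -
  obtain f where f: "homeomorphic_map (X i) (Y i) (f i)" if "i \<in> I" for i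
    using assms unfolding homeomorphic_space by metis
  let ?A = "\<lambda>i. {i} \<times> topspace (Y i)"
  have U: "(\<Union>i\<in>I. ?A i) = topspace (sum_topology Y I)"
    by auto
  have "homeomorphic_map (sum_topology X I) (subtopology (sum_topology Y I) (\<Union>i\<in>I. ?A i))
      (\<lambda>(i, x). (i, f i x))"
  proof (rule homeomorphic_map_sum_topology)
    fix i assume i: "i \<in> I"
    have "homeomorphic_map (Y i) (subtopology (sum_topology Y I) (?A i)) (Pair i)"
    proof -
      have "Pair i ` topspace (Y i) = ?A i"
        by auto
      then show ?thesis
        using embedding_map_component_injection[OF i, of Y] by (simp add: embedding_map_def)
    qed
    from homeomorphic_map_compose[OF f[OF i] this]
    show "homeomorphic_map (X i) (subtopology (sum_topology Y I) (?A i)) (\<lambda>x. (i, f i x))"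
      by (simp add: o_def)
    have "openin (sum_topology Y I) (?A i)"
      using i by (force simp: openin_sum_topology intro: openin_subopen[THEN iffD2])
    then show "openin (subtopology (sum_topology Y I) (\<Union>i\<in>I. ?A i)) (?A i)"
      unfolding U subtopology_topspace .
  qed (auto simp: disjoint_family_on_def)
  then show ?thesis
    unfolding U subtopology_topspace by (rule homeomorphic_map_imp_homeomorphic_space)
qed

section \<open>Spheres as joins of orthogonal spheres\<close>

text \<open>
  The map of classes induced by a map of representatives; meaningful on classes where \<open>F\<close> is constant.
\<close>

definition join_lift :: "('c \<Rightarrow> 'w) \<Rightarrow> 'c set \<Rightarrow> 'w" where
  "join_lift F C = the_elem (F ` C)"

lemma join_lift_class:
  assumes F: "\<And>p q. (p, q) \<in> join_rel X Y \<Longrightarrow> F p = F q"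
    and p: "p \<in> topspace (join_cylinder X Y)"
  shows "join_lift F (join_class X Y p) = F p"
proof -
  have "p \<in> join_class X Y p"
    unfolding join_class_def by (rule equiv_class_self[OF equiv_join_rel p])
  moreover have "F q = F p" if "q \<in> join_class X Y p" for q
    using that F[of p q] by (simp add: join_class_def)
  ultimately have "F ` join_class X Y p = {F p}"
    by blast
  then show ?thesis
    by (simp add: join_lift_def)
qed

text \<open>
  The join of compact spaces is compact, being a quotient of the compact cylinder, so a continuous
  bijection from it to a Hausdorff space is a homeomorphism; \<open>F\<close> descends to such a bijection exactly
  when its fibres are the join classes.
\<close>

lemma homeomorphic_map_join_lift:
  assumes F: "continuous_map (join_cylinder X Y) Z F"
    and fibres: "\<And>p q. p \<in> topspace (join_cylinder X Y) \<Longrightarrow> q \<in> topspace (join_cylinder X Y) \<Longrightarrow>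
      F p = F q \<longleftrightarrow> (p, q) \<in> join_rel X Y"
    and onto: "F ` topspace (join_cylinder X Y) = topspace Z"
    and compact: "compact_space X" "compact_space Y"
    and Z: "Hausdorff_space Z"
  shows "homeomorphic_map (join_topology X Y) Z (join_lift F)"
proof (rule continuous_imp_homeomorphic_map)
  have lift: "join_lift F (join_class X Y p) = F p" if "p \<in> topspace (join_cylinder X Y)" for p
  proof (rule join_lift_class[OF _ that])
    fix p q assume pq: "(p, q) \<in> join_rel X Y"
    then have "p \<in> topspace (join_cylinder X Y)" "q \<in> topspace (join_cylinder X Y)"
      unfolding join_rel_def by blast+
    with fibres pq show "F p = F q" by blast
  qed
  have top: "topspace (join_topology X Y) = join_class X Y ` topspace (join_cylinder X Y)"
    using quotient_imp_surjective_map[OF quotient_map_join_class[of X Y]] by simp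
  show "continuous_map (join_topology X Y) Z (join_lift F)"
    using continuous_map_eq[OF F, of "join_lift F \<circ> join_class X Y"]
    by (intro continuous_compose_quotient_map[OF quotient_map_join_class]) (simp add: lift)
  have "compact_space (top_of_set {0..pi / 2})"
    by (simp add: compact_space_subtopology)
  then have "compact_space (join_cylinder X Y)"
    using compact by (simp add: join_cylinder_def compact_space_prod_topology)
  then have "compactin (join_topology X Y) (join_class X Y ` topspace (join_cylinder X Y))"
    using quotient_imp_continuous_map[OF quotient_map_join_class]
    by (intro image_compactin) (auto simp: compact_space_def simp del: topspace_join_cylinder)
  then show "compact_space (join_topology X Y)"
    unfolding compact_space_def top .
  show "join_lift F ` topspace (join_topology X Y) = topspace Z"
    unfolding top image_image onto[symmetric] by (intro image_cong lift refl)
  show "inj_on (join_lift F) (topspace (join_topology X Y))"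
    unfolding top
  proof (rule inj_onI)
    fix c d assume c: "c \<in> join_class X Y ` topspace (join_cylinder X Y)"
      and d: "d \<in> join_class X Y ` topspace (join_cylinder X Y)"
      and eq: "join_lift F c = join_lift F d"
    obtain p where p: "p \<in> topspace (join_cylinder X Y)" "c = join_class X Y p"
      using c by (rule imageE)
    obtain q where q: "q \<in> topspace (join_cylinder X Y)" "d = join_class X Y q"
      using d by (rule imageE)
    from eq p q have "F p = F q"
      by (simp only: lift)
    with fibres[OF p(1) q(1)] join_class_eq_iff[OF p(1) q(1)] p q show "c = d"
      by simp
  qed
qed (fact Z)

lemma orthogonal_decomposition_unique:
  fixes E F :: "'w::real_inner set"
  assumes "subspace E" "subspace F" and orth: "\<And>a b. a \<in> E \<Longrightarrow> b \<in> F \<Longrightarrow> a \<bullet> b = 0"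
    and "a \<in> E" "a' \<in> E" "b \<in> F" "b' \<in> F" "a + b = a' + b'"
  shows "a = a' \<and> b = b'"
proof -
  have "a - a' = b' - b"
    using assms(8) by (simp add: algebra_simps)
  moreover have "(a - a') \<bullet> (b' - b) = 0"
    using assms by (intro orth) (auto simp: subspace_diff)
  ultimately show ?thesis
    by simp
qed

lemma continuous_map_scaleR:
  fixes g :: "'a \<Rightarrow> 'w::real_normed_vector"
  assumes "continuous_map X euclideanreal c" "continuous_map X euclidean g"
  shows "continuous_map X euclidean (\<lambda>x. c x *\<^sub>R g x)"
  using assms by (simp add: continuous_map_atin tendsto_scaleR)

lemma cos_sin_quarter_circle:
  assumes "\<theta> \<in> {0..pi / 2}"
  shows "cos \<theta> = 0 \<longleftrightarrow> \<theta> = pi / 2" "sin \<theta> = 0 \<longleftrightarrow> \<theta> = 0" "0 \<le> cos \<theta>" "0 \<le> sin \<theta>"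
proof -
  have \<theta>: "0 \<le> \<theta>" "\<theta> \<le> pi / 2"
    using assms by auto
  have "cos \<theta> > 0" if "\<theta> \<noteq> pi / 2"
    using \<theta> that pi_gt_zero by (intro cos_gt_zero_pi) linarith+
  then show "cos \<theta> = 0 \<longleftrightarrow> \<theta> = pi / 2"
    using cos_pi_half by (metis less_irrefl)
  show "sin \<theta> = 0 \<longleftrightarrow> \<theta> = 0"
    using \<theta> sin_gt_zero[of \<theta>] by (cases "\<theta> = 0") auto
  show "0 \<le> cos \<theta>" "0 \<le> sin \<theta>"
    using \<theta> by (auto intro: cos_ge_zero sin_ge_zero)
qed

text \<open>
  A unit vector splits as \<open>w = a + b\<close> along \<open>E\<close> and \<open>F\<close>, and \<open>(\<parallel>a\<parallel>, \<parallel>b\<parallel>)\<close> lies on the closed quarter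
  circle, hence is \<open>(cos \<theta>, sin \<theta>)\<close> for exactly one \<open>\<theta>\<close>. The directions of \<open>a\<close> and \<open>b\<close> are determined by
  \<open>w\<close> except when the respective component vanishes, and these are precisely the identifications made
  in the join. The spheres enter through parametrisations \<open>p\<close> and \<open>m\<close>, so that the same statement
  covers the identity of the two Hodge spheres and isometric images of \<open>S\<^sup>2\<close>.
\<close>

lemma homeomorphic_map_join_orthogonal_spheres:
  fixes E F :: "'w::real_inner set"
  assumes E: "subspace E" and F: "subspace F"
    and orth: "\<And>a b. a \<in> E \<Longrightarrow> b \<in> F \<Longrightarrow> a \<bullet> b = 0"
    and sum: "\<And>w. \<exists>a\<in>E. \<exists>b\<in>F. w = a + b"
    and p: "homeomorphic_map X (top_of_set (E \<inter> sphere 0 1)) p"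
    and m: "homeomorphic_map Y (top_of_set (F \<inter> sphere 0 1)) m"
    and compact: "compact_space X" "compact_space Y"
    and nonempty: "topspace X \<noteq> {}" "topspace Y \<noteq> {}"
  defines "f \<equiv> \<lambda>(x, y, \<theta>). cos \<theta> *\<^sub>R p x + sin \<theta> *\<^sub>R m y"
  shows "homeomorphic_map (join_topology X Y) (top_of_set (sphere 0 1)) (join_lift f)"
proof (rule homeomorphic_map_join_lift)
  have p_im: "p ` topspace X = E \<inter> sphere 0 1" and m_im: "m ` topspace Y = F \<inter> sphere 0 1"
    using homeomorphic_imp_surjective_map[OF p] homeomorphic_imp_surjective_map[OF m] by simp_all
  have pE: "p x \<in> E" "norm (p x) = 1" if "x \<in> topspace X" for x
    using p_im that by auto
  have mF: "m y \<in> F" "norm (m y) = 1" if "y \<in> topspace Y" for y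
    using m_im that by auto
  have f_sphere: "norm (f (x, y, \<theta>)) = 1" if "x \<in> topspace X" "y \<in> topspace Y" for x y \<theta>
  proof -
    have "orthogonal (cos \<theta> *\<^sub>R p x) (sin \<theta> *\<^sub>R m y)"
      using orth[OF pE(1) mF(1)] that by (simp add: orthogonal_def)
    then have "(norm (f (x, y, \<theta>)))\<^sup>2 = 1"
      using pE mF that by (simp add: f_def norm_add_Pythagorean)
    then show ?thesis
      by (simp add: power2_eq_1_iff) (smt (verit) norm_ge_zero)
  qed
  show "continuous_map (join_cylinder X Y) (top_of_set (sphere 0 1)) f"
  proof (rule continuous_map_into_subtopology)
    have "continuous_map X euclidean p" "continuous_map Y euclidean m"
      using homeomorphic_imp_continuous_map[OF p] homeomorphic_imp_continuous_map[OF m]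
      by (simp_all add: continuous_map_in_subtopology)
    moreover have "continuous_map (join_cylinder X Y) X fst"
      "continuous_map (join_cylinder X Y) Y (fst \<circ> snd)"
      and t: "continuous_map (join_cylinder X Y) euclideanreal (snd \<circ> snd)"
      unfolding join_cylinder_def
      by (rule continuous_map_fst continuous_map_compose[OF continuous_map_snd continuous_map_fst]
          continuous_map_into_fulltopology[OF
            continuous_map_compose[OF continuous_map_snd continuous_map_snd]])+
    ultimately have "continuous_map (join_cylinder X Y) euclidean (p \<circ> fst)"
      "continuous_map (join_cylinder X Y) euclidean (m \<circ> (fst \<circ> snd))"
      by (auto intro: continuous_map_compose)
    moreover
    have "continuous_map (join_cylinder X Y) euclideanreal (\<lambda>z. cos (snd (snd z)))"
      "continuous_map (join_cylinder X Y) euclideanreal (\<lambda>z. sin (snd (snd z)))"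
      using continuous_map_compose[OF t, of euclideanreal cos]
        continuous_map_compose[OF t, of euclideanreal sin]
      by (simp_all add: o_def continuous_on_cos continuous_on_sin continuous_on_id)
    ultimately show "continuous_map (join_cylinder X Y) euclidean f"
      unfolding f_def case_prod_beta o_def
      by (intro continuous_map_add continuous_map_scaleR)
  qed (use f_sphere in auto)
  show "f p' = f q' \<longleftrightarrow> (p', q') \<in> join_rel X Y"
    if "p' \<in> topspace (join_cylinder X Y)" "q' \<in> topspace (join_cylinder X Y)" for p' q'
  proof -
    obtain x y \<theta> x' y' \<theta>' where pq: "p' = (x, y, \<theta>)" "q' = (x', y', \<theta>')"
      by (metis prod.exhaust)
    have *: "x \<in> topspace X" "y \<in> topspace Y" "x' \<in> topspace X" "y' \<in> topspace Y"
      and \<theta>: "0 \<le> \<theta>" "\<theta> \<le> pi / 2" "0 \<le> \<theta>'" "\<theta>' \<le> pi / 2"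
      using that by (auto simp: pq)
    have cs: "cos \<theta> \<ge> 0" "cos \<theta>' \<ge> 0" "cos \<theta> = 0 \<longleftrightarrow> \<theta> = pi / 2" "sin \<theta> = 0 \<longleftrightarrow> \<theta> = 0"
      using cos_sin_quarter_circle[of \<theta>] cos_sin_quarter_circle[of \<theta>'] \<theta> by auto
    have "f p' = f q' \<longleftrightarrow> cos \<theta> *\<^sub>R p x = cos \<theta>' *\<^sub>R p x' \<and> sin \<theta> *\<^sub>R m y = sin \<theta>' *\<^sub>R m y'"
      using orthogonal_decomposition_unique[OF E F orth, of "cos \<theta> *\<^sub>R p x" "cos \<theta>' *\<^sub>R p x'"
          "sin \<theta> *\<^sub>R m y" "sin \<theta>' *\<^sub>R m y'"] pE mF *
      by (auto simp: pq f_def E F subspace_scale)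
    also have "\<dots> \<longleftrightarrow> \<theta> = \<theta>' \<and> (p x = p x' \<or> \<theta> = pi / 2) \<and> (m y = m y' \<or> \<theta> = 0)"
    proof
      assume eq: "cos \<theta> *\<^sub>R p x = cos \<theta>' *\<^sub>R p x' \<and> sin \<theta> *\<^sub>R m y = sin \<theta>' *\<^sub>R m y'"
      then have "norm (cos \<theta> *\<^sub>R p x) = norm (cos \<theta>' *\<^sub>R p x')"
        by simp
      then have "cos \<theta> = cos \<theta>'"
        using pE * cs by simp
      then have "\<theta> = \<theta>'"
        using cos_inj_pi \<theta> by (smt (verit) pi_gt_zero field_sum_of_halves)
      with eq cs show "\<theta> = \<theta>' \<and> (p x = p x' \<or> \<theta> = pi / 2) \<and> (m y = m y' \<or> \<theta> = 0)"
        by auto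
    qed (use cs in auto)
    also have "\<dots> \<longleftrightarrow> (p', q') \<in> join_rel X Y"
      using inj_on_eq_iff[OF homeomorphic_imp_injective_map[OF p]]
        inj_on_eq_iff[OF homeomorphic_imp_injective_map[OF m]] * \<theta>
      by (auto simp: pq join_rel_def)
    finally show ?thesis .
  qed
  show "f ` topspace (join_cylinder X Y) = topspace (top_of_set (sphere 0 1))"
  proof
    show "f ` topspace (join_cylinder X Y) \<subseteq> topspace (top_of_set (sphere 0 1))"
      using f_sphere by auto
    show "topspace (top_of_set (sphere 0 1)) \<subseteq> f ` topspace (join_cylinder X Y)"
    proof
      fix w :: 'w assume "w \<in> topspace (top_of_set (sphere 0 1))"
      then have w: "norm w = 1" by simp
      obtain a b where ab: "a \<in> E" "b \<in> F" "w = a + b"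
        using sum by blast
      have "(norm a)\<^sup>2 + (norm b)\<^sup>2 = 1"
        using w ab norm_add_Pythagorean[of a b] orth by (simp add: orthogonal_def)
      then obtain \<theta> where \<theta>: "0 \<le> \<theta>" "\<theta> \<le> pi / 2" "norm a = cos \<theta>" "norm b = sin \<theta>"
        using sincos_total_pi_half[of "norm a" "norm b"] by auto
      \<comment> \<open>A vanishing component has no direction; any point of the (nonempty) sphere then serves.\<close>
      have dir: "\<exists>x\<in>topspace X'. c = norm c *\<^sub>R h x"
        if "h ` topspace X' = G \<inter> sphere 0 1" "topspace X' \<noteq> {}" "subspace G" "c \<in> G"
        for h :: "'u \<Rightarrow> 'w" and X' G c
      proof (cases "c = 0")
        case False
        then have "inverse (norm c) *\<^sub>R c \<in> h ` topspace X'"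
          unfolding that(1) using that(3,4) by (simp add: subspace_scale)
        then obtain x where "x \<in> topspace X'" "inverse (norm c) *\<^sub>R c = h x"
          by blast
        with False show ?thesis
          by (metis divideR_right inverse_eq_divide norm_eq_zero scaleR_one scaleR_scaleR right_inverse)
      qed (use that in auto)
      obtain x where "x \<in> topspace X" "a = norm a *\<^sub>R p x"
        using dir[OF p_im nonempty(1) E ab(1)] by blast
      moreover obtain y where "y \<in> topspace Y" "b = norm b *\<^sub>R m y"
        using dir[OF m_im nonempty(2) F ab(2)] by blast
      ultimately show "w \<in> f ` topspace (join_cylinder X Y)"
        using \<theta> ab by (intro image_eqI[of _ _ "(x, y, \<theta>)"]) (auto simp: f_def)
    qed
  qed
  show "Hausdorff_space (top_of_set (sphere (0::'w) 1))"
    by (simp add: Hausdorff_space_subtopology)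
qed (fact compact)+

lemma homeomorphic_map_isometric_sphere:
  fixes h :: "'u::euclidean_space \<Rightarrow> 'w::real_normed_vector"
  assumes h: "linear h" "\<And>x. norm (h x) = norm x"
  shows "homeomorphic_map (top_of_set (sphere 0 1)) (top_of_set (range h \<inter> sphere 0 1)) h"
proof (rule continuous_imp_homeomorphic_map)
  have "bounded_linear h"
    using h by (intro bounded_linear_intro[of h 1]) (auto simp: linear_add linear_scale)
  then have "continuous_on (sphere 0 1) h"
    by (rule linear_continuous_on)
  with h(2) show "continuous_map (top_of_set (sphere 0 1)) (top_of_set (range h \<inter> sphere 0 1)) h"
    by (auto simp: continuous_map_in_subtopology)
  have "h x = h y \<Longrightarrow> x = y" for x y
    using h(2)[of "x - y"] by (simp add: linear_diff[OF h(1)])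
  then show "inj_on h (topspace (top_of_set (sphere 0 1)))"
    by (rule inj_onI)
  show "h ` topspace (top_of_set (sphere 0 1)) = topspace (top_of_set (range h \<inter> sphere 0 1))"
    by (auto simp: h(2))
  show "compact_space (top_of_set (sphere (0::'u) 1))"
    by (simp add: compact_space_subtopology)
  show "Hausdorff_space (top_of_set (range h \<inter> sphere 0 1))"
    by (simp add: Hausdorff_space_subtopology)
qed

text \<open>
  The unit sphere of \<open>\<real>\<^sup>3 \<oplus> \<real>\<^sup>3\<close> is the join of the unit spheres of the two summands.
\<close>

lemma sphere_join_homeomorphic_S5: "join_topology S2 S2 homeomorphic_space S5"
proof -
  let ?E = "range (\<lambda>x::real^3. (x, 0::real^3))" and ?F = "range (\<lambda>y::real^3. (0::real^3, y))"
  have lin: "linear (\<lambda>x::real^3. (x, 0::real^3))" "linear (\<lambda>y::real^3. (0::real^3, y))"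
    by (auto simp: linear_iff)
  have "\<exists>h. homeomorphic_map (join_topology S2 S2) (top_of_set (sphere (0::(real^3) \<times> (real^3)) 1)) h"
  proof (rule exI, rule homeomorphic_map_join_orthogonal_spheres)
    show "subspace ?E" "subspace ?F"
      using lin by (auto intro: linear_subspace_image)
    show "homeomorphic_map S2 (top_of_set (?E \<inter> sphere 0 1)) (\<lambda>x. (x, 0))"
      "homeomorphic_map S2 (top_of_set (?F \<inter> sphere 0 1)) (\<lambda>y. (0, y))"
      using lin by (auto intro!: homeomorphic_map_isometric_sphere simp: norm_Pair)
    show "\<exists>a\<in>?E. \<exists>b\<in>?F. w = a + b" for w
      by (cases w) auto
  qed (auto simp: compact_space_subtopology)
  moreover have "sphere (0::(real^3) \<times> (real^3)) 1 homeomorphic sphere (0::real^6) 1"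
    by (rule homeomorphic_spheres_gen) auto
  then obtain f g where "homeomorphism (sphere (0::(real^3) \<times> (real^3)) 1) (sphere (0::real^6) 1) f g"
    unfolding homeomorphic_def by blast
  then have "homeomorphic_maps (top_of_set (sphere (0::(real^3) \<times> (real^3)) 1)) S5 f g"
    unfolding homeomorphism_def homeomorphic_maps_def by auto
  then have "top_of_set (sphere (0::(real^3) \<times> (real^3)) 1) homeomorphic_space S5"
    unfolding homeomorphic_space_def by blast
  ultimately show ?thesis
    using homeomorphic_map_imp_homeomorphic_space homeomorphic_space_trans by blast
qed

section \<open>Oriented orthonormal frames\<close>

lemma det_4:
  "det (A::'a::comm_ring_1^4^4) =
    A$1$1 * A$2$2 * A$3$3 * A$4$4 - A$1$1 * A$2$2 * A$3$4 * A$4$3 -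
    A$1$1 * A$2$3 * A$3$2 * A$4$4 + A$1$1 * A$2$3 * A$3$4 * A$4$2 +
    A$1$1 * A$2$4 * A$3$2 * A$4$3 - A$1$1 * A$2$4 * A$3$3 * A$4$2 -
    A$1$2 * A$2$1 * A$3$3 * A$4$4 + A$1$2 * A$2$1 * A$3$4 * A$4$3 +
    A$1$2 * A$2$3 * A$3$1 * A$4$4 - A$1$2 * A$2$3 * A$3$4 * A$4$1 -
    A$1$2 * A$2$4 * A$3$1 * A$4$3 + A$1$2 * A$2$4 * A$3$3 * A$4$1 +
    A$1$3 * A$2$1 * A$3$2 * A$4$4 - A$1$3 * A$2$1 * A$3$4 * A$4$2 -
    A$1$3 * A$2$2 * A$3$1 * A$4$4 + A$1$3 * A$2$2 * A$3$4 * A$4$1 +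
    A$1$3 * A$2$4 * A$3$1 * A$4$2 - A$1$3 * A$2$4 * A$3$2 * A$4$1 -
    A$1$4 * A$2$1 * A$3$2 * A$4$3 + A$1$4 * A$2$1 * A$3$3 * A$4$2 +
    A$1$4 * A$2$2 * A$3$1 * A$4$3 - A$1$4 * A$2$2 * A$3$3 * A$4$1 -
    A$1$4 * A$2$3 * A$3$1 * A$4$2 + A$1$4 * A$2$3 * A$3$2 * A$4$1"
proof -
  have f1234: "finite {2::4, 3, 4}" "1 \<notin> {2::4, 3, 4}" by auto
  have f234: "finite {3::4, 4}" "2 \<notin> {3::4, 4}" by auto
  have f34: "finite {4::4}" "3 \<notin> {4::4}" by auto
  show ?thesis
    unfolding det_def UNIV_4
    unfolding sum_over_permutations_insert[OF f1234]
    unfolding sum_over_permutations_insert[OF f234]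
    unfolding sum_over_permutations_insert[OF f34]
    unfolding permutes_sing
    by (simp add: sign_swap_id permutation_swap_id sign_compose sign_id permutation_compose
        swap_id_eq transpose_def)
qed

definition orthonormal :: "'a::real_inner ^ 'n \<Rightarrow> bool" where
  "orthonormal e \<longleftrightarrow> (\<forall>i j. e $ i \<bullet> e $ j = (if i = j then 1 else 0))"

text \<open>
  The columns of \<open>A\<close> are the coordinates of the new frame, as in the definition of equal orientation;
  with this convention successive changes of frame multiply in reading order.
\<close>

definition change_frame :: "'a::real_vector ^ 'n \<Rightarrow> real ^ 'n ^ 'n \<Rightarrow> 'a ^ 'n" where
  "change_frame e A = (\<chi> j. \<Sum>i\<in>UNIV. A $ i $ j *\<^sub>R e $ i)"

lemma change_frame_mult: "change_frame (change_frame e A) B = change_frame e (A ** B)"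
proof -
  have "(\<Sum>i\<in>UNIV. B $ i $ j *\<^sub>R (\<Sum>k\<in>UNIV. A $ k $ i *\<^sub>R e $ k)) =
      (\<Sum>k\<in>UNIV. (\<Sum>i\<in>UNIV. A $ k $ i * B $ i $ j) *\<^sub>R e $ k)" for j
    unfolding scaleR_sum_right scaleR_sum_left by (subst sum.swap) (simp add: mult.commute)
  then show ?thesis
    by (simp add: change_frame_def matrix_matrix_mult_def vec_eq_iff)
qed

lemma change_frame_one [simp]: "change_frame e (mat 1) = e"
  by (simp add: change_frame_def mat_def vec_eq_iff if_distrib[of "\<lambda>c. c *\<^sub>R _"] sum.delta' cong: if_cong)

lemma same_orientation_iff:
  "(e, f) \<in> same_orientation \<longleftrightarrow>
    e \<in> ordered_bases \<and> f \<in> ordered_bases \<and> (\<exists>A. det A > 0 \<and> f = change_frame e A)"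
  by (auto simp: same_orientation_def change_frame_def vec_eq_iff)

lemma equiv_same_orientation: "equiv ordered_bases same_orientation"
proof (rule equivI)
  show "same_orientation \<subseteq> ordered_bases \<times> (ordered_bases :: ('a ^ 'b) set)"
    by (auto simp: same_orientation_iff)
  show "refl_on ordered_bases (same_orientation :: ('a ^ 'b) rel)"
    by (rule refl_onI) (auto simp: same_orientation_iff intro!: exI[of _ "mat 1"])
  show "sym (same_orientation :: ('a ^ 'b) rel)"
  proof (rule symI)
    fix e f :: "'a ^ 'b"
    assume "(e, f) \<in> same_orientation"
    then obtain A where A: "e \<in> ordered_bases" "f \<in> ordered_bases" "det A > 0" "f = change_frame e A"
      by (auto simp: same_orientation_iff)
    then obtain B where inv: "A ** B = mat 1"
      using invertible_det_nz[of A] by (auto simp: invertible_def)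
    then have "det A * det B = 1"
      by (metis det_I det_mul)
    with A(3) have "det B > 0"
      by (metis zero_less_mult_pos zero_less_one)
    moreover have "e = change_frame f B"
      by (simp add: A(4) change_frame_mult inv)
    ultimately show "(f, e) \<in> same_orientation"
      using A by (auto simp: same_orientation_iff)
  qed
  show "trans (same_orientation :: ('a ^ 'b) rel)"
  proof (rule transI)
    fix e f g :: "'a ^ 'b"
    assume "(e, f) \<in> same_orientation" "(f, g) \<in> same_orientation"
    then obtain A B where "e \<in> ordered_bases" "g \<in> ordered_bases" "det A > 0" "det B > 0"
      "g = change_frame e (A ** B)"
      by (auto simp: same_orientation_iff change_frame_mult)
    then show "(e, g) \<in> same_orientation"
      by (auto simp: same_orientation_iff det_mul intro!: exI[of _ "A ** B"])
  qed
qed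

lemma orthonormal_imp_ordered_basis:
  fixes e :: "'a::euclidean_space ^ 'n"
  assumes e: "orthonormal e" and dim: "CARD('n) = DIM('a)"
  shows "e \<in> ordered_bases"
proof -
  have inj: "inj (($) e)"
  proof (rule injI)
    fix i j assume "e $ i = e $ j"
    then have "e $ i \<bullet> e $ j = e $ i \<bullet> e $ i" by simp
    with e show "i = j" by (simp add: orthonormal_def split: if_splits)
  qed
  have "pairwise orthogonal (range (($) e))"
    using e by (auto simp: pairwise_def orthogonal_def orthonormal_def)
  moreover have "0 \<notin> range (($) e)"
  proof
    assume "0 \<in> range (($) e)"
    then obtain i where "e $ i = 0" by auto
    moreover have "e $ i \<bullet> e $ i = 1"
      using e by (simp add: orthonormal_def)
    ultimately show False by simp
  qed
  ultimately have ind: "independent (range (($) e))"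
    by (rule pairwise_orthogonal_independent)
  moreover have "card (range (($) e)) = DIM('a)"
    using dim by (simp add: card_image inj)
  ultimately have "span (range (($) e)) = UNIV"
    using card_ge_dim_independent[of "range (($) e)" UNIV] by auto
  with inj ind show ?thesis
    by (simp add: ordered_bases_def)
qed

lemma orthonormal_expansion:
  fixes e :: "'a::euclidean_space ^ 'n"
  assumes e: "orthonormal e" and dim: "CARD('n) = DIM('a)"
  shows "x = (\<Sum>i\<in>UNIV. (e $ i \<bullet> x) *\<^sub>R e $ i)"
proof -
  let ?y = "x - (\<Sum>i\<in>UNIV. (e $ i \<bullet> x) *\<^sub>R e $ i)"
  have "orthogonal ?y (e $ j)" for j
  proof -
    have "(\<Sum>i\<in>UNIV. (e $ i \<bullet> x) *\<^sub>R e $ i) \<bullet> e $ j = e $ j \<bullet> x"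
      using e by (simp add: orthonormal_def inner_sum_left if_distrib[of "\<lambda>c. _ * c"] cong: if_cong)
    then show ?thesis
      by (simp add: orthogonal_def inner_diff_left inner_commute[of x "e $ j"])
  qed
  moreover have "?y \<in> span (range (($) e))"
    using orthonormal_imp_ordered_basis[OF assms] by (simp add: ordered_bases_def)
  ultimately have "orthogonal ?y ?y"
    using orthogonal_to_span[of ?y "range (($) e)" ?y] by blast
  then have "?y = 0"
    by (simp only: orthogonal_self)
  then show ?thesis
    by (simp only: right_minus_eq)
qed

definition gram :: "'a::real_inner ^ 'n \<Rightarrow> 'a ^ 'n \<Rightarrow> real ^ 'n ^ 'n" where
  "gram e f = (\<chi> i j. e $ i \<bullet> f $ j)"

lemma change_frame_gram:
  fixes e :: "'a::euclidean_space ^ 'n"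
  assumes "orthonormal e" "CARD('n) = DIM('a)"
  shows "change_frame e (gram e f) = f"
  by (simp add: change_frame_def gram_def vec_eq_iff orthonormal_expansion[OF assms, symmetric])

lemma gram_change_frame:
  assumes "orthonormal e"
  shows "gram e (change_frame e A) = A"
  using assms by (simp add: gram_def change_frame_def orthonormal_def vec_eq_iff inner_sum_right
      if_distrib[of "\<lambda>c. _ * c"] cong: if_cong)

lemma det_gram_orthonormal:
  fixes e :: "'a::euclidean_space ^ 'n"
  assumes e: "orthonormal e" and f: "orthonormal f" and dim: "CARD('n) = DIM('a)"
  shows "det (gram e f) = 1 \<or> det (gram e f) = - 1"
proof (rule det_orthogonal_matrix)
  have "gram f e = transpose (gram e f)"
    by (simp add: gram_def transpose_def inner_commute)
  moreover have "gram a b ** gram b a = mat 1" if a: "orthonormal a" and b: "orthonormal b" for a b :: "'a^'n"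
  proof -
    have "gram a b ** gram b a = gram a (change_frame (change_frame a (gram a b)) (gram b a))"
      by (simp only: gram_change_frame[OF a] change_frame_mult)
    also have "\<dots> = gram a a"
      by (simp only: change_frame_gram[OF a dim] change_frame_gram[OF b dim])
    also have "\<dots> = mat 1"
      using a by (simp add: gram_def mat_def orthonormal_def)
    finally show ?thesis .
  qed
  ultimately show "orthogonal_matrix (gram e f)"
    using e f by (metis orthogonal_matrix_def)
qed

definition flip_last :: "'v::uminus ^ 4 \<Rightarrow> 'v ^ 4" where
  "flip_last e = (\<chi> i. if i = 4 then - e $ i else e $ i)"

definition frame4 :: "'v \<Rightarrow> 'v \<Rightarrow> 'v \<Rightarrow> 'v \<Rightarrow> 'v ^ 4" where
  "frame4 a b c d = (\<chi> i. if i = 1 then a else if i = 2 then b else if i = 3 then c else d)"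

lemma frame4_nth [simp]:
  "frame4 a b c d $ 1 = a" "frame4 a b c d $ 2 = b" "frame4 a b c d $ 3 = c" "frame4 a b c d $ 4 = d"
  by (simp_all add: frame4_def)

locale oriented_four_space =
  fixes \<omega> :: "('a::euclidean_space ^ 4) set"
  assumes dim4: "DIM('a) = 4" and orientation: "\<omega> \<in> orientations"
begin

lemma card_4_eq_dim: "CARD(4) = DIM('a)"
  by (simp add: dim4)

lemma orthonormal_of_oriented: "e \<in> oriented_orthonormal_bases \<omega> \<Longrightarrow> orthonormal e"
  by (simp add: oriented_orthonormal_bases_def orthonormal_def)

lemma oriented_iff_det_gram:
  assumes e: "e \<in> oriented_orthonormal_bases \<omega>" and f: "orthonormal f"
  shows "f \<in> oriented_orthonormal_bases \<omega> \<longleftrightarrow> det (gram e f) > 0"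
proof -
  note on = orthonormal_of_oriented[OF e]
  have "e \<in> \<omega>"
    using e by (simp add: oriented_orthonormal_bases_def)
  then have "f \<in> \<omega> \<longleftrightarrow> (e, f) \<in> same_orientation"
    using orientation quotient_eq_iff[OF equiv_same_orientation, of \<omega> \<omega> e f]
      in_quotient_imp_closed[OF equiv_same_orientation, of \<omega> e f]
    by (auto simp: orientations_def)
  also have "\<dots> \<longleftrightarrow> det (gram e f) > 0"
    using orthonormal_imp_ordered_basis[OF on card_4_eq_dim] orthonormal_imp_ordered_basis[OF f card_4_eq_dim]
      gram_change_frame[OF on] change_frame_gram[OF on card_4_eq_dim, of f]
    by (metis same_orientation_iff)
  finally show ?thesis
    using f by (simp add: oriented_orthonormal_bases_def orthonormal_def)
qed

lemma det_gram_oriented: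
  assumes "e \<in> oriented_orthonormal_bases \<omega>" "f \<in> oriented_orthonormal_bases \<omega>"
  shows "det (gram e f) = 1"
  using oriented_iff_det_gram[OF assms(1), of f] det_gram_orthonormal[of e f] assms
    orthonormal_of_oriented card_4_eq_dim by fastforce

text \<open>
  The coordinates of an orthonormal frame in a basis from \<open>\<omega>\<close> form an invertible matrix; reversing the
  last vector changes the sign of its determinant.
\<close>

lemma orthonormal_or_flip_oriented:
  assumes f: "orthonormal f"
  shows "f \<in> oriented_orthonormal_bases \<omega> \<or> flip_last f \<in> oriented_orthonormal_bases \<omega>"
proof -
  obtain e where e: "e \<in> ordered_bases" "\<omega> = same_orientation `` {e}"
    using orientation unfolding orientations_def by (rule quotientE)
  have flip: "orthonormal (flip_last f)"
    using f by (auto simp: orthonormal_def flip_last_def)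
  have "\<exists>c. f $ j = (\<Sum>i\<in>UNIV. c i *\<^sub>R e $ i)" for j
  proof -
    have "f $ j \<in> span (range (($) e))"
      using e by (simp add: ordered_bases_def)
    then obtain u where u: "f $ j = (\<Sum>v\<in>range (($) e). u v *\<^sub>R v)"
      by (auto simp: span_finite)
    also have "\<dots> = (\<Sum>i\<in>UNIV. u (e $ i) *\<^sub>R e $ i)"
      using e(1) by (simp add: ordered_bases_def sum.reindex)
    finally show ?thesis by (rule exI[of _ "\<lambda>i. u (e $ i)"])
  qed
  then obtain c where c: "f $ j = (\<Sum>i\<in>UNIV. c j i *\<^sub>R e $ i)" for j
    by metis
  define A :: "real^4^4" where "A = (\<chi> i j. c j i)"
  have fA: "f = change_frame e A"
    by (simp add: change_frame_def A_def vec_eq_iff c[symmetric])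
  \<comment> \<open>A kernel vector of \<open>A\<close> would be a linear relation among the vectors of the orthonormal frame \<open>f\<close>.\<close>
  have "det A \<noteq> 0"
  proof
    assume "det A = 0"
    then obtain v where v: "A *v v = 0" "v \<noteq> 0"
      by (metis invertible_det_nz matrix_left_invertible_ker invertible_left_inverse)
    have "(\<Sum>j\<in>UNIV. v $ j *\<^sub>R f $ j) = (\<Sum>i\<in>UNIV. (A *v v) $ i *\<^sub>R e $ i)"
      unfolding fA change_frame_def matrix_vector_mult_def vec_lambda_beta scaleR_sum_right scaleR_sum_left
      by (subst sum.swap) (simp add: mult.commute)
    then have "(\<Sum>j\<in>UNIV. v $ j *\<^sub>R f $ j) \<bullet> f $ k = 0" for k
      by (simp add: v)
    then have "v $ k = 0" for k
      using f by (simp add: orthonormal_def inner_sum_left if_distrib[of "\<lambda>c. _ * c"] cong: if_cong)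
    with v show False
      by (simp add: vec_eq_iff)
  qed
  moreover have "f \<in> \<omega>" if "det A > 0"
    using that fA e orthonormal_imp_ordered_basis[OF f card_4_eq_dim]
    by (auto simp: same_orientation_iff)
  moreover have "flip_last f \<in> \<omega>" if "det A < 0"
  proof -
    define B :: "real^4^4" where "B = (\<chi> i j. if j = 4 then - A $ i $ j else A $ i $ j)"
    have "det B = - det A"
      by (simp add: det_4 B_def)
    moreover have "flip_last f = change_frame e B"
      by (simp add: vec_eq_iff flip_last_def fA change_frame_def B_def sum_negf)
    ultimately show ?thesis
      using that e orthonormal_imp_ordered_basis[OF flip card_4_eq_dim]
      by (auto simp: same_orientation_iff intro!: exI[of _ B])
  qed
  ultimately show ?thesis
    using f flip by (auto simp: oriented_orthonormal_bases_def orthonormal_def neq_iff)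
qed

text \<open>
  The plane orthogonal to \<open>x\<close> and \<open>y\<close> has an orthonormal basis; if the resulting frame has the wrong
  orientation, reversing its last vector corrects this without touching \<open>x\<close> and \<open>y\<close>.
\<close>

lemma extend_to_oriented_frame:
  assumes x: "norm x = 1" and y: "norm y = 1" and xy: "x \<bullet> y = 0"
  obtains e where "e \<in> oriented_orthonormal_bases \<omega>" "e $ 1 = x" "e $ 2 = y"
proof -
  let ?S = "{z::'a. \<forall>w\<in>span {x, y}. orthogonal w z}"
  have S: "subspace ?S"
    by (auto simp: subspace_def orthogonal_def inner_add_right)
  have "x \<noteq> y" "x \<noteq> 0" "y \<noteq> 0"
    using x y xy by auto
  then have "independent {x, y}"
    using xy by (intro pairwise_orthogonal_independent) (auto simp: pairwise_def orthogonal_def inner_commute)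
  then have "dim (span {x, y}) = 2"
    using \<open>x \<noteq> y\<close> by (simp add: dim_eq_card_independent)
  moreover have "dim ?S + dim (span {x, y}) = DIM('a)"
    using dim_subspace_orthogonal_to_vectors[of "span {x, y}" UNIV] by simp
  ultimately have "dim ?S = 2"
    by (simp add: dim4)
  then obtain B where B: "B \<subseteq> ?S" "pairwise orthogonal B" "\<And>z. z \<in> B \<Longrightarrow> norm z = 1" "card B = 2"
    using orthonormal_basis_subspace[OF S] by metis
  then obtain z w where zw: "B = {z, w}" "z \<noteq> w"
    by (auto simp: card_2_iff)
  define f :: "'a^4" where "f = (\<chi> i. if i = 1 then x else if i = 2 then y else if i = 3 then z else w)"
  have "orthogonal x z" "orthogonal x w" "orthogonal y z" "orthogonal y w"
    using B(1) zw by (auto intro: span_base)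
  then have "orthonormal f"
    using zw B x y xy unfolding orthonormal_def forall_4 f_def
    by (simp add: orthogonal_def inner_commute pairwise_def dot_square_norm)
  moreover have "f $ 1 = x" "f $ 2 = y" "flip_last f $ 1 = x" "flip_last f $ 2 = y"
    by (simp_all add: f_def flip_last_def)
  ultimately show ?thesis
    using orthonormal_or_flip_oriented[of f] that by metis
qed

lemma oriented_frame_exists: "oriented_orthonormal_bases \<omega> \<noteq> {}"
proof -
  have "\<exists>x\<in>Basis. \<exists>y\<in>Basis. x \<noteq> (y::'a)"
    using dim4 by (metis card_1_singleton_iff card_eq_0_iff finite_Basis is_singletonI' is_singleton_altdef numeral_eq_one_iff semiring_norm(85) zero_neq_numeral)
  then obtain x y :: 'a where "x \<in> Basis" "y \<in> Basis" "x \<noteq> y" by blast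
  then show ?thesis
    using extend_to_oriented_frame[of x y] by (auto simp: inner_Basis)
qed

text \<open>
  Together with \<open>e\<close> itself, these frames have the six coordinate planes, up to sign, as the planes
  spanned by their first two vectors. So statements about \<open>e\<^sub>1 \<and> e\<^sub>2\<close> for all oriented frames reach every
  basis bivector.
\<close>

lemma oriented_even_permutations:
  assumes e: "e \<in> oriented_orthonormal_bases \<omega>"
  shows "frame4 (e $ 3) (e $ 4) (e $ 1) (e $ 2) \<in> oriented_orthonormal_bases \<omega>"
    "frame4 (e $ 1) (e $ 3) (e $ 4) (e $ 2) \<in> oriented_orthonormal_bases \<omega>"
    "frame4 (e $ 4) (e $ 2) (e $ 1) (e $ 3) \<in> oriented_orthonormal_bases \<omega>"
    "frame4 (e $ 1) (e $ 4) (e $ 2) (e $ 3) \<in> oriented_orthonormal_bases \<omega>"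
    "frame4 (e $ 2) (e $ 3) (e $ 1) (e $ 4) \<in> oriented_orthonormal_bases \<omega>"
proof -
  have o: "e $ i \<bullet> e $ j = (if i = j then 1 else 0)" for i j
    using orthonormal_of_oriented[OF e] by (simp add: orthonormal_def)
  show "frame4 (e $ 3) (e $ 4) (e $ 1) (e $ 2) \<in> oriented_orthonormal_bases \<omega>"
    "frame4 (e $ 1) (e $ 3) (e $ 4) (e $ 2) \<in> oriented_orthonormal_bases \<omega>"
    "frame4 (e $ 4) (e $ 2) (e $ 1) (e $ 3) \<in> oriented_orthonormal_bases \<omega>"
    "frame4 (e $ 1) (e $ 4) (e $ 2) (e $ 3) \<in> oriented_orthonormal_bases \<omega>"
    "frame4 (e $ 2) (e $ 3) (e $ 1) (e $ 4) \<in> oriented_orthonormal_bases \<omega>"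
    by (subst oriented_iff_det_gram[OF e];
        simp add: orthonormal_def forall_4 det_4 gram_def o)+
qed

end

section \<open>Coordinates of bivectors\<close>

lemma bilinear_bivector_form: "bilinear (bivector_form b)"
  and bivector_form_self [simp]: "bivector_form b x x = 0"
  using bivector_form[of b] by auto

lemma bivector_form_linear:
  "bivector_form b (x + y) z = bivector_form b x z + bivector_form b y z"
  "bivector_form b z (x + y) = bivector_form b z x + bivector_form b z y"
  "bivector_form b (c *\<^sub>R x) z = c * bivector_form b x z"
  "bivector_form b z (c *\<^sub>R x) = c * bivector_form b z x"
  using bilinear_bivector_form[of b] by (simp_all add: bilinear_iff)

lemma bivector_form_swap: "bivector_form b y x = - bivector_form b x y"
proof -
  have "bivector_form b (x + y) (x + y) = 0"
    by (rule bivector_form_self)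
  then have "bivector_form b x y + bivector_form b y x = 0"
    unfolding bivector_form_linear by simp
  then show ?thesis
    by simp
qed

lemma bivector_eqI: "(\<And>x y. bivector_form b x y = bivector_form c x y) \<Longrightarrow> b = c"
  by (metis bivector_form_inject ext)

lemma bivector_eqI_basis:
  assumes "\<And>x y. x \<in> B \<Longrightarrow> y \<in> B \<Longrightarrow> bivector_form b x y = bivector_form c x y" and "span B = UNIV"
  shows "b = c"
  by (rule bivector_eqI, rule bilinear_eq[OF bilinear_bivector_form bilinear_bivector_form])
    (use assms in auto)

text \<open>
  The values of the form \<open>b\<close> are its inner products with decomposable bivectors, so in an orthonormal
  frame they are the coordinates of \<open>b\<close>.
\<close>

lemma inner_bivector_wedge: "b \<bullet> (x \<and>\<^sub>V y) = bivector_form b x y"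
proof -
  have "bivector_form b x y = (\<Sum>i\<in>Basis. \<Sum>j\<in>Basis. (x \<bullet> i) * (y \<bullet> j) * bivector_form b i j)" for x y
  proof -
    have "bivector_form b x y =
        bivector_form b (\<Sum>i\<in>Basis. (x \<bullet> i) *\<^sub>R i) (\<Sum>j\<in>Basis. (y \<bullet> j) *\<^sub>R j)"
      by (simp add: euclidean_representation)
    also have "\<dots> = (\<Sum>i\<in>Basis. \<Sum>j\<in>Basis. (x \<bullet> i) * (y \<bullet> j) * bivector_form b i j)"
      using bilinear_bivector_form[of b]
      by (simp add: bilinear_sum sum.cartesian_product bivector_form_linear case_prod_beta mult.assoc
          mult.left_commute)
    finally show ?thesis .
  qed
  note this[of x y] this[of y x]
  moreover have "b \<bullet> (x \<and>\<^sub>V y) = ((\<Sum>i\<in>Basis. \<Sum>j\<in>Basis. (x \<bullet> i) * (y \<bullet> j) * bivector_form b i j) -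
      (\<Sum>i\<in>Basis. \<Sum>j\<in>Basis. (y \<bullet> i) * (x \<bullet> j) * bivector_form b i j)) / 2"
    by (simp add: inner_bivector.rep_eq wedge.rep_eq algebra_simps sum_subtractf)
  ultimately show ?thesis
    by (simp add: bivector_form_swap[of b y x])
qed

lemma wedge_linear:
  "(x + y) \<and>\<^sub>V z = x \<and>\<^sub>V z + y \<and>\<^sub>V z" "z \<and>\<^sub>V (x + y) = z \<and>\<^sub>V x + z \<and>\<^sub>V y"
  "(c *\<^sub>R x) \<and>\<^sub>V z = c *\<^sub>R (x \<and>\<^sub>V z)" "z \<and>\<^sub>V (c *\<^sub>R x) = c *\<^sub>R (z \<and>\<^sub>V x)"
  "(- x) \<and>\<^sub>V z = - (x \<and>\<^sub>V z)" "z \<and>\<^sub>V (- x) = - (z \<and>\<^sub>V x)"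
  by (transfer; simp add: fun_eq_iff inner_add_left algebra_simps)+

lemma wedge_swap: "y \<and>\<^sub>V x = - (x \<and>\<^sub>V y)"
  by transfer (simp add: fun_eq_iff)

lemma wedge_self [simp]: "x \<and>\<^sub>V x = 0"
  by transfer (simp add: fun_eq_iff)

lemma bivector_map_linear: "linear g \<Longrightarrow> linear (bivector_map g)"
  by (rule linearI; rule bivector_eqI)
    (simp_all add: bivector_form_map plus_bivector.rep_eq scaleR_bivector.rep_eq)

lemma bivector_frame_expansion:
  fixes e :: "'a::euclidean_space ^ 4" and b :: "'a bivector"
  assumes e: "orthonormal e" and dim: "DIM('a) = 4"
  shows "b =
    bivector_form b (e $ 1) (e $ 2) *\<^sub>R (e $ 1 \<and>\<^sub>V e $ 2) + bivector_form b (e $ 1) (e $ 3) *\<^sub>R (e $ 1 \<and>\<^sub>V e $ 3)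
    + bivector_form b (e $ 1) (e $ 4) *\<^sub>R (e $ 1 \<and>\<^sub>V e $ 4) + bivector_form b (e $ 2) (e $ 3) *\<^sub>R (e $ 2 \<and>\<^sub>V e $ 3)
    + bivector_form b (e $ 2) (e $ 4) *\<^sub>R (e $ 2 \<and>\<^sub>V e $ 4) + bivector_form b (e $ 3) (e $ 4) *\<^sub>R (e $ 3 \<and>\<^sub>V e $ 4)"
  (is "b = ?c")
proof (rule bivector_eqI_basis[of "range (($) e)"])
  have o: "e $ i \<bullet> e $ j = (if i = j then 1 else 0)" for i j
    using e by (simp add: orthonormal_def)
  show "span (range (($) e)) = UNIV"
    using orthonormal_imp_ordered_basis[OF e] dim by (simp add: ordered_bases_def)
  have "\<forall>i j. bivector_form b (e $ i) (e $ j) = bivector_form ?c (e $ i) (e $ j)"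
    unfolding forall_4 plus_bivector.rep_eq scaleR_bivector.rep_eq wedge.rep_eq o
    using bivector_form_swap[of b "e $ 2" "e $ 1"] bivector_form_swap[of b "e $ 3" "e $ 1"]
      bivector_form_swap[of b "e $ 4" "e $ 1"] bivector_form_swap[of b "e $ 3" "e $ 2"]
      bivector_form_swap[of b "e $ 4" "e $ 2"] bivector_form_swap[of b "e $ 4" "e $ 3"]
    by simp
  then show "bivector_form b x y = bivector_form ?c x y"
    if "x \<in> range (($) e)" "y \<in> range (($) e)" for x y
    using that by blast
qed

lemma wedge_diff:
  "(x - y) \<and>\<^sub>V z = x \<and>\<^sub>V z - y \<and>\<^sub>V z" "z \<and>\<^sub>V (x - y) = z \<and>\<^sub>V x - z \<and>\<^sub>V y"
  by (transfer; simp add: fun_eq_iff algebra_simps)+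

lemma inner_frame:
  fixes e :: "'a::euclidean_space ^ 4" and b c :: "'a bivector"
  assumes "orthonormal e" "DIM('a) = 4"
  shows "b \<bullet> c = bivector_form b (e $ 1) (e $ 2) * bivector_form c (e $ 1) (e $ 2)
    + bivector_form b (e $ 1) (e $ 3) * bivector_form c (e $ 1) (e $ 3)
    + bivector_form b (e $ 1) (e $ 4) * bivector_form c (e $ 1) (e $ 4)
    + bivector_form b (e $ 2) (e $ 3) * bivector_form c (e $ 2) (e $ 3)
    + bivector_form b (e $ 2) (e $ 4) * bivector_form c (e $ 2) (e $ 4)
    + bivector_form b (e $ 3) (e $ 4) * bivector_form c (e $ 3) (e $ 4)"
  by (subst (1) bivector_frame_expansion[OF assms, of c])
    (simp add: inner_add_right inner_bivector_wedge mult.commute)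

section \<open>The Hodge star\<close>

text \<open>
  The Hodge star written out in one frame. That it is the same map for all frames of one orientation
  is the content of \<open>frame_star_oriented\<close>.
\<close>

definition frame_star :: "'a::euclidean_space ^ 4 \<Rightarrow> 'a bivector \<Rightarrow> 'a bivector" where
  "frame_star e b =
    bivector_form b (e $ 3) (e $ 4) *\<^sub>R (e $ 1 \<and>\<^sub>V e $ 2) - bivector_form b (e $ 2) (e $ 4) *\<^sub>R (e $ 1 \<and>\<^sub>V e $ 3)
    + bivector_form b (e $ 2) (e $ 3) *\<^sub>R (e $ 1 \<and>\<^sub>V e $ 4) + bivector_form b (e $ 1) (e $ 4) *\<^sub>R (e $ 2 \<and>\<^sub>V e $ 3)
    - bivector_form b (e $ 1) (e $ 3) *\<^sub>R (e $ 2 \<and>\<^sub>V e $ 4) + bivector_form b (e $ 1) (e $ 2) *\<^sub>R (e $ 3 \<and>\<^sub>V e $ 4)"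

lemma linear_frame_star: "linear (frame_star e)"
  by (rule linearI) (simp_all add: frame_star_def plus_bivector.rep_eq scaleR_bivector.rep_eq algebra_simps)

lemmas bivector_rep_eqs = plus_bivector.rep_eq minus_bivector.rep_eq uminus_bivector.rep_eq
  scaleR_bivector.rep_eq zero_bivector.rep_eq wedge.rep_eq

lemma frame_star_coordinates:
  assumes "orthonormal e"
  shows "bivector_form (frame_star e b) (e $ 1) (e $ 2) = bivector_form b (e $ 3) (e $ 4)"
    "bivector_form (frame_star e b) (e $ 1) (e $ 3) = - bivector_form b (e $ 2) (e $ 4)"
    "bivector_form (frame_star e b) (e $ 1) (e $ 4) = bivector_form b (e $ 2) (e $ 3)"
    "bivector_form (frame_star e b) (e $ 2) (e $ 3) = bivector_form b (e $ 1) (e $ 4)"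
    "bivector_form (frame_star e b) (e $ 2) (e $ 4) = - bivector_form b (e $ 1) (e $ 3)"
    "bivector_form (frame_star e b) (e $ 3) (e $ 4) = bivector_form b (e $ 1) (e $ 2)"
  using assms by (simp_all add: frame_star_def bivector_rep_eqs orthonormal_def)

lemma inner_frame_star:
  fixes e :: "'a::euclidean_space ^ 4" and b c :: "'a bivector"
  assumes "orthonormal e" "DIM('a) = 4"
  shows "frame_star e b \<bullet> frame_star e c = b \<bullet> c"
  unfolding inner_frame[OF assms] frame_star_coordinates[OF assms(1)] by simp

text \<open>
  This is the Laplace expansion of a \<open>4 \<times> 4\<close> determinant along its first two columns.
\<close>

lemma inner_frame_star_wedge:
  "frame_star e (x \<and>\<^sub>V y) \<bullet> (z \<and>\<^sub>V w) = det (gram e (frame4 x y z w))"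
  unfolding inner_bivector_wedge frame_star_def bivector_rep_eqs det_4 gram_def vec_lambda_beta frame4_nth
  by (simp add: inner_commute[of x] inner_commute[of y] inner_commute[of z] inner_commute[of w] algebra_simps)

context oriented_four_space
begin

text \<open>
  Both sides are unit vectors, because the star permutes an orthonormal basis up to signs, and their
  inner product is the determinant of the change of frame, which is \<open>1\<close>. Two unit vectors with inner
  product \<open>1\<close> are equal.
\<close>

lemma frame_star_oriented:
  assumes e: "e \<in> oriented_orthonormal_bases \<omega>" and f: "f \<in> oriented_orthonormal_bases \<omega>"
  shows "frame_star e (f $ 1 \<and>\<^sub>V f $ 2) = f $ 3 \<and>\<^sub>V f $ 4"
proof -
  let ?s = "frame_star e (f $ 1 \<and>\<^sub>V f $ 2)" and ?t = "f $ 3 \<and>\<^sub>V f $ 4"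
  have o: "f $ i \<bullet> f $ j = (if i = j then 1 else 0)" for i j
    using orthonormal_of_oriented[OF f] by (simp add: orthonormal_def)
  have "frame4 (f $ 1) (f $ 2) (f $ 3) (f $ 4) = f"
    by (simp add: vec_eq_iff forall_4)
  then have "?s \<bullet> ?t = 1"
    using det_gram_oriented[OF e f] by (simp add: inner_frame_star_wedge)
  moreover have "?s \<bullet> ?s = 1" "?t \<bullet> ?t = 1"
    unfolding inner_frame_star[OF orthonormal_of_oriented[OF e] dim4] by (simp_all add: inner_wedge o)
  ultimately have "(?s - ?t) \<bullet> (?s - ?t) = 0"
    by (simp add: inner_diff_left inner_diff_right inner_commute)
  then show ?thesis
    by simp
qed

text \<open>
  The bivectors \<open>e\<^sub>1 \<and> e\<^sub>2\<close> span, so a linear map is determined by its values on them. This gives the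
  uniqueness of the Hodge star, its being an involution, and its equivariance.
\<close>

lemma linear_eq_on_oriented:
  fixes f g :: "'a bivector \<Rightarrow> 'w::real_vector"
  assumes f: "linear f" and g: "linear g"
    and eq: "\<And>e. e \<in> oriented_orthonormal_bases \<omega> \<Longrightarrow> f (e $ 1 \<and>\<^sub>V e $ 2) = g (e $ 1 \<and>\<^sub>V e $ 2)"
  shows "f b = g b"
proof -
  obtain e where e: "e \<in> oriented_orthonormal_bases \<omega>"
    using oriented_frame_exists by blast
  have neg: "f (e $ 4 \<and>\<^sub>V e $ 2) = - f (e $ 2 \<and>\<^sub>V e $ 4)" "g (e $ 4 \<and>\<^sub>V e $ 2) = - g (e $ 2 \<and>\<^sub>V e $ 4)"
    using linear_neg[OF f] linear_neg[OF g] by (metis wedge_swap)+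
  show ?thesis
    using eq[OF e] eq[OF oriented_even_permutations(1)[OF e]] eq[OF oriented_even_permutations(2)[OF e]]
      eq[OF oriented_even_permutations(3)[OF e]] eq[OF oriented_even_permutations(4)[OF e]]
      eq[OF oriented_even_permutations(5)[OF e]]
    by (subst (1 2) bivector_frame_expansion[OF orthonormal_of_oriented[OF e] dim4])
      (simp add: neg linear_add[OF f] linear_add[OF g] linear_scale[OF f] linear_scale[OF g])
qed

lemma hodge_star_frame_star:
  assumes e: "e \<in> oriented_orthonormal_bases \<omega>"
  shows "hodge_star \<omega> = frame_star e"
  unfolding hodge_star_def
proof (rule the_equality)
  show "linear (frame_star e) \<and>
    (\<forall>f\<in>oriented_orthonormal_bases \<omega>. frame_star e (f $ 1 \<and>\<^sub>V f $ 2) = f $ 3 \<and>\<^sub>V f $ 4)"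
    using linear_frame_star frame_star_oriented[OF e] by blast
  fix s assume s: "linear s \<and>
    (\<forall>f\<in>oriented_orthonormal_bases \<omega>. s (f $ 1 \<and>\<^sub>V f $ 2) = f $ 3 \<and>\<^sub>V f $ 4)"
  then show "s = frame_star e"
    using linear_eq_on_oriented[of s "frame_star e"] linear_frame_star frame_star_oriented[OF e]
    by (metis ext)
qed

lemma linear_hodge_star: "linear (hodge_star \<omega>)"
  using oriented_frame_exists hodge_star_frame_star linear_frame_star by fastforce

lemma hodge_star_wedge:
  assumes "e \<in> oriented_orthonormal_bases \<omega>"
  shows "hodge_star \<omega> (e $ 1 \<and>\<^sub>V e $ 2) = e $ 3 \<and>\<^sub>V e $ 4"
    "hodge_star \<omega> (e $ 3 \<and>\<^sub>V e $ 4) = e $ 1 \<and>\<^sub>V e $ 2"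
  using frame_star_oriented[OF assms] hodge_star_frame_star[OF assms] oriented_even_permutations(1)[OF assms]
    frame_star_oriented[OF assms, of "frame4 (e $ 3) (e $ 4) (e $ 1) (e $ 2)"] assms by simp_all

lemma hodge_star_involution: "hodge_star \<omega> (hodge_star \<omega> b) = b"
  using linear_eq_on_oriented[of "hodge_star \<omega> \<circ> hodge_star \<omega>" id b] linear_hodge_star
  by (simp add: linear_compose linear_id hodge_star_wedge)

lemma inner_hodge_star: "hodge_star \<omega> b \<bullet> hodge_star \<omega> c = b \<bullet> c"
  using oriented_frame_exists hodge_star_frame_star inner_frame_star orthonormal_of_oriented dim4 by fastforce

lemma subspace_selfdual: "subspace (selfdual \<omega>)"
  and subspace_antiselfdual: "subspace (antiselfdual \<omega>)"
  using linear_hodge_star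
  by (auto simp: subspace_def selfdual_def antiselfdual_def linear_add linear_scale linear_0)

lemma selfdual_orthogonal_antiselfdual:
  assumes "a \<in> selfdual \<omega>" "b \<in> antiselfdual \<omega>"
  shows "a \<bullet> b = 0"
  using inner_hodge_star[of a b] assms by (simp add: selfdual_def antiselfdual_def)

lemma hodge_decomposition: "\<exists>a\<in>selfdual \<omega>. \<exists>b\<in>antiselfdual \<omega>. w = a + b"
proof (intro bexI)
  show "w = (1/2) *\<^sub>R (w + hodge_star \<omega> w) + (1/2) *\<^sub>R (w - hodge_star \<omega> w)"
    by (simp add: algebra_simps flip: scaleR_add_left)
  show "(1/2) *\<^sub>R (w - hodge_star \<omega> w) \<in> antiselfdual \<omega>"
    using linear_hodge_star by (simp add: antiselfdual_def linear_scale linear_diff hodge_star_involution flip: scaleR_minus_right)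
  show "(1/2) *\<^sub>R (w + hodge_star \<omega> w) \<in> selfdual \<omega>"
    using linear_hodge_star by (simp add: selfdual_def linear_scale linear_add hodge_star_involution add.commute)
qed

end

text \<open>
  For \<open>\<sigma> = 1\<close> and \<open>\<sigma> = -1\<close> this is an isometry of \<open>\<real>\<^sup>3\<close> onto the \<open>\<sigma>\<close>-eigenspace of the Hodge star.
\<close>

definition hodge_eigenvector :: "'a::euclidean_space ^ 4 \<Rightarrow> real \<Rightarrow> real ^ 3 \<Rightarrow> 'a bivector" where
  "hodge_eigenvector e \<sigma> x =
    (x $ 1 / sqrt 2) *\<^sub>R (e $ 1 \<and>\<^sub>V e $ 2 + \<sigma> *\<^sub>R (e $ 3 \<and>\<^sub>V e $ 4)) +
    (x $ 2 / sqrt 2) *\<^sub>R (e $ 1 \<and>\<^sub>V e $ 3 - \<sigma> *\<^sub>R (e $ 2 \<and>\<^sub>V e $ 4)) +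
    (x $ 3 / sqrt 2) *\<^sub>R (e $ 1 \<and>\<^sub>V e $ 4 + \<sigma> *\<^sub>R (e $ 2 \<and>\<^sub>V e $ 3))"

lemma linear_hodge_eigenvector: "linear (hodge_eigenvector e \<sigma>)"
  by (rule linearI) (simp_all add: hodge_eigenvector_def algebra_simps add_divide_distrib)

lemma hodge_eigenvector_coordinates:
  assumes "orthonormal e"
  shows "bivector_form (hodge_eigenvector e \<sigma> x) (e $ 1) (e $ 2) = x $ 1 / sqrt 2"
    "bivector_form (hodge_eigenvector e \<sigma> x) (e $ 1) (e $ 3) = x $ 2 / sqrt 2"
    "bivector_form (hodge_eigenvector e \<sigma> x) (e $ 1) (e $ 4) = x $ 3 / sqrt 2"
    "bivector_form (hodge_eigenvector e \<sigma> x) (e $ 2) (e $ 3) = \<sigma> * x $ 3 / sqrt 2"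
    "bivector_form (hodge_eigenvector e \<sigma> x) (e $ 2) (e $ 4) = - \<sigma> * x $ 2 / sqrt 2"
    "bivector_form (hodge_eigenvector e \<sigma> x) (e $ 3) (e $ 4) = \<sigma> * x $ 1 / sqrt 2"
  using assms by (simp_all add: hodge_eigenvector_def bivector_rep_eqs orthonormal_def)

lemma norm_hodge_eigenvector:
  fixes e :: "'a::euclidean_space ^ 4"
  assumes "orthonormal e" "DIM('a) = 4" "\<sigma>\<^sup>2 = 1"
  shows "norm (hodge_eigenvector e \<sigma> x) = norm x"
proof -
  have ss: "\<sigma> * (\<sigma> * c) = c" for c
    using assms(3) by (metis mult.assoc mult_1 power2_eq_square)
  have "hodge_eigenvector e \<sigma> x \<bullet> hodge_eigenvector e \<sigma> x = x \<bullet> x"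
    unfolding inner_frame[OF assms(1,2)] hodge_eigenvector_coordinates[OF assms(1)]
    by (simp add: ss inner_vec_def sum_3 power2_eq_square field_simps)
  then show ?thesis
    by (simp add: norm_eq_sqrt_inner)
qed

lemma range_hodge_eigenvector:
  fixes e :: "'a::euclidean_space ^ 4"
  assumes e: "orthonormal e" and dim: "DIM('a) = 4" and \<sigma>: "\<sigma>\<^sup>2 = 1"
  shows "range (hodge_eigenvector e \<sigma>) = {b. frame_star e b = \<sigma> *\<^sub>R b}"
proof (intro equalityI subsetI)
  fix b assume "b \<in> range (hodge_eigenvector e \<sigma>)"
  then obtain x where x: "b = hodge_eigenvector e \<sigma> x" by blast
  have ss: "\<sigma> * (\<sigma> * c) = c" for c
    using \<sigma> by (metis mult.assoc mult_1 power2_eq_square)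
  have "frame_star e b = \<sigma> *\<^sub>R b"
    unfolding x frame_star_def hodge_eigenvector_coordinates[OF e]
    by (simp add: ss hodge_eigenvector_def algebra_simps)
  then show "b \<in> {b. frame_star e b = \<sigma> *\<^sub>R b}" by simp
next
  fix b assume "b \<in> {b. frame_star e b = \<sigma> *\<^sub>R b}"
  then have b: "frame_star e b = \<sigma> *\<^sub>R b" by simp
  let ?b = "\<lambda>i j. bivector_form b (e $ i) (e $ j)"
  have "?b 3 4 = \<sigma> * ?b 1 2" "?b 2 4 = - (\<sigma> * ?b 1 3)" "?b 2 3 = \<sigma> * ?b 1 4"
    using frame_star_coordinates(1-3)[OF e, of b] by (simp_all add: b scaleR_bivector.rep_eq)
  then have "b = hodge_eigenvector e \<sigma> (sqrt 2 *\<^sub>R vector [?b 1 2, ?b 1 3, ?b 1 4])"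
    by (subst (1) bivector_frame_expansion[OF e dim, of b])
      (simp add: hodge_eigenvector_def algebra_simps)
  then show "b \<in> range (hodge_eigenvector e \<sigma>)" by blast
qed

context oriented_four_space
begin

lemma range_hodge_eigenvector_selfdual:
  assumes e: "e \<in> oriented_orthonormal_bases \<omega>"
  shows "range (hodge_eigenvector e 1) = selfdual \<omega>"
    "range (hodge_eigenvector e (- 1)) = antiselfdual \<omega>"
  using range_hodge_eigenvector[OF orthonormal_of_oriented[OF e] dim4, of 1]
    range_hodge_eigenvector[OF orthonormal_of_oriented[OF e] dim4, of "- 1"]
  by (simp_all add: selfdual_def antiselfdual_def hodge_star_frame_star[OF e])

lemma homeomorphic_map_hodge_eigenvector:
  assumes e: "e \<in> oriented_orthonormal_bases \<omega>"
  shows "homeomorphic_map S2 (T_plus \<omega>) (hodge_eigenvector e 1)"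
    "homeomorphic_map S2 (T_minus \<omega>) (hodge_eigenvector e (- 1))"
  using homeomorphic_map_isometric_sphere[OF linear_hodge_eigenvector
      norm_hodge_eigenvector[OF orthonormal_of_oriented[OF e] dim4], of 1]
    homeomorphic_map_isometric_sphere[OF linear_hodge_eigenvector
      norm_hodge_eigenvector[OF orthonormal_of_oriented[OF e] dim4], of "- 1"]
  by (simp_all add: range_hodge_eigenvector_selfdual[OF e] S_plus_def S_minus_def Int_commute)

section \<open>Equivariance\<close>

lemma SO_oriented:
  assumes "g \<in> SO \<omega>" "e \<in> oriented_orthonormal_bases \<omega>"
  shows "(\<chi> i. g (e $ i)) \<in> oriented_orthonormal_bases \<omega>"
  using assms by (simp add: SO_def oriented_orthonormal_bases_def orthogonal_transformation_def)

text \<open>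
  An element of \<open>SO(V)\<close> carries oriented frames to oriented frames, so both composites send
  \<open>e\<^sub>1 \<and> e\<^sub>2\<close> to \<open>g e\<^sub>3 \<and> g e\<^sub>4\<close>.
\<close>

lemma hodge_star_bivector_map:
  assumes g: "g \<in> SO \<omega>"
  shows "hodge_star \<omega> (bivector_map g b) = bivector_map g (hodge_star \<omega> b)"
proof -
  have lin: "linear g"
    using g by (simp add: SO_def orthogonal_transformation_def)
  have "(hodge_star \<omega> \<circ> bivector_map g) b = (bivector_map g \<circ> hodge_star \<omega>) b"
  proof (rule linear_eq_on_oriented[of "hodge_star \<omega> \<circ> bivector_map g" "bivector_map g \<circ> hodge_star \<omega>"])
    fix e assume e: "e \<in> oriented_orthonormal_bases \<omega>"
    show "(hodge_star \<omega> \<circ> bivector_map g) (e $ 1 \<and>\<^sub>V e $ 2) = (bivector_map g \<circ> hodge_star \<omega>) (e $ 1 \<and>\<^sub>V e $ 2)"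
      using hodge_star_wedge(1)[OF SO_oriented[OF g e]] hodge_star_wedge(1)[OF e]
      by (simp add: bivector_map_wedge lin)
  qed (intro linear_compose linear_hodge_star bivector_map_linear lin)+
  then show ?thesis by simp
qed

lemma norm_bivector_map:
  assumes g: "g \<in> SO \<omega>"
  shows "norm (bivector_map g b) = norm b"
proof -
  have lin: "linear g" and iso: "g x \<bullet> g y = x \<bullet> y" for x y
    using g by (auto simp: SO_def orthogonal_transformation_def)
  have adj: "adjoint g (g x) = x" for x
    by (rule vector_eq_rdot[THEN iffD1]) (simp add: adjoint_works[OF lin] adjoint_clauses[OF lin] iso)
  obtain e where e: "e \<in> oriented_orthonormal_bases \<omega>"
    using oriented_frame_exists by blast
  \<comment> \<open>\<open>b\<close> has the same coordinates in \<open>e\<close> as its image in the frame \<open>g e\<close>.\<close>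
  have "bivector_map g b \<bullet> bivector_map g b = b \<bullet> b"
    using inner_frame[OF orthonormal_of_oriented[OF SO_oriented[OF g e]] dim4, of "bivector_map g b" "bivector_map g b"]
      inner_frame[OF orthonormal_of_oriented[OF e] dim4, of b b]
    by (simp add: bivector_form_map[OF lin] adj)
  then show ?thesis
    by (simp add: norm_eq_sqrt_inner)
qed

lemma hodge_spheres_invariant:
  assumes g: "g \<in> SO \<omega>"
  shows "u \<in> S_plus \<omega> \<Longrightarrow> bivector_map g u \<in> S_plus \<omega>"
    and "u \<in> S_minus \<omega> \<Longrightarrow> bivector_map g u \<in> S_minus \<omega>"
  using g hodge_star_bivector_map[OF g, of u] norm_bivector_map[OF g, of u]
    linear_neg[OF bivector_map_linear, of g u]
  by (auto simp: S_plus_def S_minus_def selfdual_def antiselfdual_def SO_def orthogonal_transformation_def)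

section \<open>Normal forms\<close>

text \<open>
  Gram--Schmidt: neither rescaling \<open>x\<close> nor subtracting a multiple of it from \<open>y\<close> changes the wedge
  product beyond a scalar factor.
\<close>

lemma wedge_normal_form:
  assumes "x \<and>\<^sub>V y \<noteq> 0"
  obtains e where "e \<in> oriented_orthonormal_bases \<omega>"
    "x \<and>\<^sub>V y = norm (x \<and>\<^sub>V y) *\<^sub>R (e $ 1 \<and>\<^sub>V e $ 2)"
proof -
  have x0: "x \<noteq> 0"
    using assms wedge_linear(3)[of 0 0 y] by auto
  define a where "a = x /\<^sub>R norm x"
  define z where "z = y - (a \<bullet> y) *\<^sub>R a"
  have a: "norm a = 1" "x = norm x *\<^sub>R a"
    using x0 by (simp_all add: a_def)
  have "a \<bullet> a = 1"
    using a by (simp add: dot_square_norm)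
  then have az: "a \<bullet> z = 0"
    by (simp add: z_def inner_diff_right)
  have "y = z + (a \<bullet> y) *\<^sub>R a"
    by (simp add: z_def)
  then have xy: "x \<and>\<^sub>V y = norm x *\<^sub>R (a \<and>\<^sub>V z)"
    by (metis a(2) wedge_linear(2,3,4) wedge_self scaleR_zero_right add.right_neutral)
  then have z0: "z \<noteq> 0"
    using assms wedge_linear(4)[of a 0 0] by auto
  define c where "c = z /\<^sub>R norm z"
  have c: "norm c = 1" "z = norm z *\<^sub>R c" "a \<bullet> c = 0"
    using z0 az by (simp_all add: c_def)
  obtain e where e: "e \<in> oriented_orthonormal_bases \<omega>" "e $ 1 = a" "e $ 2 = c"
    using extend_to_oriented_frame[OF a(1) c(1,3)] by blast
  have xy': "x \<and>\<^sub>V y = (norm x * norm z) *\<^sub>R (a \<and>\<^sub>V c)"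
    using xy by (subst (asm) c(2)) (simp add: wedge_linear)
  moreover have "norm (a \<and>\<^sub>V c) = 1"
    using a c by (simp add: norm_eq_sqrt_inner inner_wedge inner_commute)
  ultimately have "norm (x \<and>\<^sub>V y) = norm x * norm z"
    by simp
  with xy' e that show ?thesis
    by metis
qed

text \<open>
  The number \<open>\<langle>\<star>b, b\<rangle>\<close> is twice the Pfaffian \<open>b\<^sub>1\<^sub>2 b\<^sub>3\<^sub>4 - b\<^sub>1\<^sub>3 b\<^sub>2\<^sub>4 + b\<^sub>1\<^sub>4 b\<^sub>2\<^sub>3\<close>. If it vanishes and
  \<open>b\<^sub>1\<^sub>2 \<noteq> 0\<close>, then \<open>b\<close> is, up to the factor \<open>1 / b\<^sub>1\<^sub>2\<close>, the wedge product of its contractions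
  \<open>b(e\<^sub>1, -)\<close> and \<open>b(e\<^sub>2, -)\<close>.
\<close>

lemma isotropic_imp_wedge:
  assumes b0: "b \<noteq> 0" and iso: "hodge_star \<omega> b \<bullet> b = 0"
  obtains x y where "b = x \<and>\<^sub>V y"
proof -
  have "\<exists>e\<in>oriented_orthonormal_bases \<omega>. b \<bullet> (e $ 1 \<and>\<^sub>V e $ 2) \<noteq> 0"
  proof (rule ccontr)
    assume "\<not> ?thesis"
    then have "b \<bullet> c = 0" for c
      using linear_eq_on_oriented[of "\<lambda>c. b \<bullet> c" "\<lambda>_. 0" c]
      by (auto simp: linear_iff inner_add_right)
    with b0 show False
      using inner_eq_zero_iff by blast
  qed
  then obtain e where e: "e \<in> oriented_orthonormal_bases \<omega>"
    and b12: "bivector_form b (e $ 1) (e $ 2) \<noteq> 0"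
    by (auto simp: inner_bivector_wedge)
  note on = orthonormal_of_oriented[OF e]
  let ?b = "\<lambda>i j. bivector_form b (e $ i) (e $ j)"
  have "?b 1 2 * ?b 3 4 - ?b 1 3 * ?b 2 4 + ?b 1 4 * ?b 2 3 = 0"
    using iso unfolding hodge_star_frame_star[OF e] inner_frame[OF on dim4] frame_star_coordinates[OF on]
    by (simp add: algebra_simps)
  then have b34: "?b 3 4 = (?b 1 3 * ?b 2 4 - ?b 1 4 * ?b 2 3) / ?b 1 2"
    using b12 by (simp add: field_simps)
  have "b = (e $ 2 + (?b 1 3 / ?b 1 2) *\<^sub>R e $ 3 + (?b 1 4 / ?b 1 2) *\<^sub>R e $ 4) \<and>\<^sub>V
      (- (?b 1 2 *\<^sub>R e $ 1) + ?b 2 3 *\<^sub>R e $ 3 + ?b 2 4 *\<^sub>R e $ 4)"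
    by (subst (1) bivector_frame_expansion[OF on dim4, of b])
      (simp add: b34 b12 wedge_linear wedge_diff wedge_swap[of "e $ 1" "e $ 2"] wedge_swap[of "e $ 1" "e $ 3"]
        wedge_swap[of "e $ 1" "e $ 4"] wedge_swap[of "e $ 3" "e $ 4"]  algebra_simps diff_divide_distrib)
  then show ?thesis
    using that by blast
qed

text \<open>
  This is the transitivity of \<open>SO(V)\<close> on \<open>S\<^sub>+ \<times> S\<^sub>-\<close> in terms of frames. Since \<open>\<star>(u + v) = u - v\<close> is
  orthogonal to \<open>u + v\<close>, the sum is isotropic and thus a multiple of some \<open>e\<^sub>1 \<and> e\<^sub>2\<close>; the star then turns
  \<open>u - v\<close> into the same multiple of \<open>e\<^sub>3 \<and> e\<^sub>4\<close>, and the two relations determine \<open>u\<close> and \<open>v\<close>.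
\<close>

lemma hodge_pair_frame:
  assumes u: "u \<in> S_plus \<omega>" and v: "v \<in> S_minus \<omega>"
  obtains e where "e \<in> oriented_orthonormal_bases \<omega>"
    "u = (1 / sqrt 2) *\<^sub>R (e $ 1 \<and>\<^sub>V e $ 2 + e $ 3 \<and>\<^sub>V e $ 4)"
    "v = (1 / sqrt 2) *\<^sub>R (e $ 1 \<and>\<^sub>V e $ 2 - e $ 3 \<and>\<^sub>V e $ 4)"
proof -
  have uv: "u \<bullet> u = 1" "v \<bullet> v = 1" "u \<bullet> v = 0" "hodge_star \<omega> (u + v) = u - v"
    using u v selfdual_orthogonal_antiselfdual[of u v] linear_add[OF linear_hodge_star]
    by (auto simp: S_plus_def S_minus_def selfdual_def antiselfdual_def dot_square_norm)
  have n: "norm (u + v) = sqrt 2"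
    using uv by (simp add: norm_eq_sqrt_inner inner_add_left inner_add_right inner_commute)
  then have "u + v \<noteq> 0" by auto
  moreover have "hodge_star \<omega> (u + v) \<bullet> (u + v) = 0"
    using uv by (simp add: inner_add_left inner_add_right inner_diff_left inner_diff_right inner_commute)
  ultimately obtain x y where xy: "u + v = x \<and>\<^sub>V y"
    by (rule isotropic_imp_wedge)
  then obtain e where e: "e \<in> oriented_orthonormal_bases \<omega>"
    "u + v = sqrt 2 *\<^sub>R (e $ 1 \<and>\<^sub>V e $ 2)"
    using wedge_normal_form[of x y] n \<open>u + v \<noteq> 0\<close> by metis
  then have e': "u - v = sqrt 2 *\<^sub>R (e $ 3 \<and>\<^sub>V e $ 4)"
    using uv(4) linear_scale[OF linear_hodge_star] hodge_star_wedge(1)[OF e(1)] by metis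
  have s: "1 / sqrt 2 = sqrt 2 / (2::real)"
    by (simp add: real_div_sqrt field_simps)
  have "u = (1/2) *\<^sub>R ((u + v) + (u - v))" "v = (1/2) *\<^sub>R ((u + v) - (u - v))"
    by (simp_all add: algebra_simps flip: scaleR_add_left)
  then have "u = (1 / sqrt 2) *\<^sub>R (e $ 1 \<and>\<^sub>V e $ 2 + e $ 3 \<and>\<^sub>V e $ 4)"
    "v = (1 / sqrt 2) *\<^sub>R (e $ 1 \<and>\<^sub>V e $ 2 - e $ 3 \<and>\<^sub>V e $ 4)"
    unfolding e(2) e' s by (simp_all add: algebra_simps)
  with e(1) that show ?thesis by blast
qed

end

section \<open>Rank and singular values\<close>

text \<open>
  The skew operator of the normal form maps the plane of \<open>e\<^sub>1, e\<^sub>2\<close> onto itself, and the plane of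
  \<open>e\<^sub>3, e\<^sub>4\<close> onto itself or to \<open>0\<close> according to whether \<open>t \<noteq> 0\<close>.
\<close>

lemma bivector_rank_normal_form:
  fixes e :: "'a::euclidean_space ^ 4"
  assumes e: "orthonormal e" and dim: "DIM('a) = 4" and r: "r \<noteq> 0"
  shows "bivector_rank (r *\<^sub>R (e $ 1 \<and>\<^sub>V e $ 2) + t *\<^sub>R (e $ 3 \<and>\<^sub>V e $ 4)) = 2 \<longleftrightarrow> t = 0"
proof -
  have o: "e $ i \<bullet> e $ j = (if i = j then 1 else 0)" for i j
    using e by (simp add: orthonormal_def)
  define b where "b = r *\<^sub>R (e $ 1 \<and>\<^sub>V e $ 2) + t *\<^sub>R (e $ 3 \<and>\<^sub>V e $ 4)"
  define R where "R = {y. \<exists>x. \<forall>z. y \<bullet> z = bivector_form b x z}"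
  have b: "bivector_form b x z = r * ((e $ 1 \<bullet> x) * (e $ 2 \<bullet> z) - (e $ 1 \<bullet> z) * (e $ 2 \<bullet> x))
      + t * ((e $ 3 \<bullet> x) * (e $ 4 \<bullet> z) - (e $ 3 \<bullet> z) * (e $ 4 \<bullet> x))" for x z
    by (simp add: b_def bivector_rep_eqs)
  have "e $ 1 \<in> R" "e $ 2 \<in> R"
    unfolding R_def b
    by (rule CollectI, rule exI[of _ "- (1 / r) *\<^sub>R e $ 2"], simp add: o r,
        rule CollectI, rule exI[of _ "(1 / r) *\<^sub>R e $ 1"], simp add: o r)
  have inj: "inj (($) e)" and ind: "independent (range (($) e))"
    using orthonormal_imp_ordered_basis[OF e] dim by (auto simp: ordered_bases_def)
  have "dim R = 2" if "t = 0"
  proof (rule dim_unique)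
    show "{e $ 1, e $ 2} \<subseteq> R"
      using \<open>e $ 1 \<in> R\<close> \<open>e $ 2 \<in> R\<close> by simp
    show "independent {e $ 1, e $ 2}"
      by (rule independent_mono[OF ind]) auto
    show "card {e $ 1, e $ 2} = 2"
      using inj by (simp add: inj_eq)
    show "R \<subseteq> span {e $ 1, e $ 2}"
    proof
      fix y assume "y \<in> R"
      then obtain x where "\<forall>z. y \<bullet> z = bivector_form b x z"
        by (auto simp: R_def)
      then have "\<forall>z. y \<bullet> z = ((r * (e $ 1 \<bullet> x)) *\<^sub>R e $ 2 - (r * (e $ 2 \<bullet> x)) *\<^sub>R e $ 1) \<bullet> z"
        using that by (simp add: b inner_diff_left algebra_simps)
      then have "y = (r * (e $ 1 \<bullet> x)) *\<^sub>R e $ 2 - (r * (e $ 2 \<bullet> x)) *\<^sub>R e $ 1"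
        by (simp only: vector_eq_rdot)
      then show "y \<in> span {e $ 1, e $ 2}"
        by (simp add: span_diff span_scale span_base)
    qed
  qed
  moreover have "dim R \<noteq> 2" if "t \<noteq> 0"
  proof -
    have "e $ 3 \<in> R" "e $ 4 \<in> R"
      unfolding R_def b
      by (rule CollectI, rule exI[of _ "- (1 / t) *\<^sub>R e $ 4"], simp add: o that,
          rule CollectI, rule exI[of _ "(1 / t) *\<^sub>R e $ 3"], simp add: o that)
    with \<open>e $ 1 \<in> R\<close> \<open>e $ 2 \<in> R\<close> have "\<forall>i. e $ i \<in> R"
      by (simp add: forall_4)
    then have "card (range (($) e)) \<le> dim R"
      using ind by (intro independent_card_le_dim) auto
    then show ?thesis
      by (simp add: card_image inj)
  qed
  ultimately show ?thesis
    by (auto simp: bivector_rank_def R_def b_def)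
qed

lemma sin_eq_cos_iff:
  assumes "\<theta> \<in> {0..pi / 2}"
  shows "sin \<theta> = cos \<theta> \<longleftrightarrow> \<theta> = pi / 4"
proof
  assume "sin \<theta> = cos \<theta>"
  then have eq: "sin \<theta> = sin (pi / 2 - \<theta>)"
    by (simp add: sin_diff)
  have "\<theta> = pi / 2 - \<theta>"
    by (rule sin_inj_pi[OF _ _ _ _ eq]) (use assms in simp_all)
  then show "\<theta> = pi / 4" by simp
next
  assume "\<theta> = pi / 4"
  then show "sin \<theta> = cos \<theta>"
    by (simp only: sin_45 cos_45)
qed

context oriented_four_space
begin

text \<open>
  In the common frame of \<open>u\<close> and \<open>v\<close> the coefficients of \<open>e\<^sub>1 \<and> e\<^sub>2\<close> and \<open>e\<^sub>3 \<and> e\<^sub>4\<close> are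
  \<open>(cos \<theta> \<plusminus> sin \<theta>) / \<surd>2\<close>.
\<close>

lemma singular_values_join:
  assumes u: "u \<in> S_plus \<omega>" and v: "v \<in> S_minus \<omega>" and \<theta>: "\<theta> \<in> {0..pi / 2}"
  shows "singular_values \<omega> (cos \<theta> *\<^sub>R u + sin \<theta> *\<^sub>R v)
    ((cos \<theta> + sin \<theta>) / sqrt 2) (\<bar>cos \<theta> - sin \<theta>\<bar> / sqrt 2)"
proof -
  obtain e where e: "e \<in> oriented_orthonormal_bases \<omega>"
    "u = (1 / sqrt 2) *\<^sub>R (e $ 1 \<and>\<^sub>V e $ 2 + e $ 3 \<and>\<^sub>V e $ 4)"
    "v = (1 / sqrt 2) *\<^sub>R (e $ 1 \<and>\<^sub>V e $ 2 - e $ 3 \<and>\<^sub>V e $ 4)"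
    using hodge_pair_frame[OF u v] by metis
  define \<epsilon> :: real where "\<epsilon> = (if cos \<theta> \<ge> sin \<theta> then 1 else - 1)"
  have \<epsilon>: "\<epsilon> * (\<bar>cos \<theta> - sin \<theta>\<bar> / sqrt 2) = (cos \<theta> - sin \<theta>) / sqrt 2"
    by (simp add: \<epsilon>_def)
  have "cos \<theta> *\<^sub>R u + sin \<theta> *\<^sub>R v = ((cos \<theta> + sin \<theta>) / sqrt 2) *\<^sub>R (e $ 1 \<and>\<^sub>V e $ 2) +
      (\<epsilon> * (\<bar>cos \<theta> - sin \<theta>\<bar> / sqrt 2)) *\<^sub>R (e $ 3 \<and>\<^sub>V e $ 4)"
    unfolding \<epsilon> by (simp add: e(2,3) algebra_simps add_divide_distrib diff_divide_distrib)
  moreover have "\<bar>cos \<theta> - sin \<theta>\<bar> \<le> cos \<theta> + sin \<theta>"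
    using cos_sin_quarter_circle(3,4)[OF \<theta>] by linarith
  moreover have "\<epsilon> \<in> {1, - 1}"
    by (simp add: \<epsilon>_def)
  ultimately show ?thesis
    using e(1) unfolding singular_values_def by (intro conjI) (auto simp: divide_right_mono)
qed

text \<open>
  Conversely every normal form of a unit bivector arises in this way, so its singular values are
  functions of \<open>\<theta>\<close> alone.
\<close>

lemma join_of_singular_values:
  assumes sv: "singular_values \<omega> b r\<^sub>1 r\<^sub>2" and b: "norm b = 1"
  obtains u v \<theta> where "u \<in> S_plus \<omega>" "v \<in> S_minus \<omega>" "\<theta> \<in> {0..pi / 2}"
    "b = cos \<theta> *\<^sub>R u + sin \<theta> *\<^sub>R v"
    "r\<^sub>1 = (cos \<theta> + sin \<theta>) / sqrt 2" "r\<^sub>2 = \<bar>cos \<theta> - sin \<theta>\<bar> / sqrt 2"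
proof -
  obtain e \<epsilon> where e: "e \<in> oriented_orthonormal_bases \<omega>" and \<epsilon>: "\<epsilon> = 1 \<or> \<epsilon> = - 1"
    and be: "b = r\<^sub>1 *\<^sub>R (e $ 1 \<and>\<^sub>V e $ 2) + (\<epsilon> * r\<^sub>2) *\<^sub>R (e $ 3 \<and>\<^sub>V e $ 4)" and r: "r\<^sub>2 \<le> r\<^sub>1" "0 \<le> r\<^sub>2"
    using sv unfolding singular_values_def by blast
  have o: "e $ i \<bullet> e $ j = (if i = j then 1 else 0)" for i j
    using orthonormal_of_oriented[OF e] by (simp add: orthonormal_def)
  \<comment> \<open>The norms of the selfdual and the antiselfdual part of \<open>b\<close>.\<close>
  define c where "c = (r\<^sub>1 + \<epsilon> * r\<^sub>2) / sqrt 2"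
  define s where "s = (r\<^sub>1 - \<epsilon> * r\<^sub>2) / sqrt 2"
  have "b \<bullet> b = 1"
    using b by (simp add: dot_square_norm)
  then have "r\<^sub>1 * r\<^sub>1 + r\<^sub>2 * r\<^sub>2 = 1"
    using \<epsilon> by (auto simp: be inner_add_left inner_add_right inner_wedge o)
  then have "c\<^sup>2 + s\<^sup>2 = 1"
    using \<epsilon> by (auto simp: c_def s_def power2_eq_square field_simps)
  moreover have "c \<ge> 0" "s \<ge> 0"
    using r \<epsilon> by (auto simp: c_def s_def)
  ultimately obtain \<theta> where \<theta>: "0 \<le> \<theta>" "\<theta> \<le> pi / 2" "c = cos \<theta>" "s = sin \<theta>"
    using sincos_total_pi_half[of c s] by auto
  let ?u = "(1 / sqrt 2) *\<^sub>R (e $ 1 \<and>\<^sub>V e $ 2 + e $ 3 \<and>\<^sub>V e $ 4)"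
  let ?v = "(1 / sqrt 2) *\<^sub>R (e $ 1 \<and>\<^sub>V e $ 2 - e $ 3 \<and>\<^sub>V e $ 4)"
  have cs: "c + s = sqrt 2 * r\<^sub>1" "c - s = sqrt 2 * (\<epsilon> * r\<^sub>2)"
    by (simp_all add: c_def s_def field_simps)
  show ?thesis
  proof
    have "norm ?u = 1" "norm ?v = 1"
      by (simp_all add: norm_eq_sqrt_inner inner_add_left inner_add_right inner_diff_left inner_diff_right
          inner_wedge o)
    then show "?u \<in> S_plus \<omega>" "?v \<in> S_minus \<omega>"
      using hodge_star_wedge[OF e] linear_hodge_star
      by (simp_all add: S_plus_def S_minus_def selfdual_def antiselfdual_def linear_scale linear_add linear_diff
          add.commute flip: scaleR_minus_right)
    show "\<theta> \<in> {0..pi / 2}"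
      using \<theta> by simp
    have "b = ((c + s) / sqrt 2) *\<^sub>R (e $ 1 \<and>\<^sub>V e $ 2) + ((c - s) / sqrt 2) *\<^sub>R (e $ 3 \<and>\<^sub>V e $ 4)"
      by (simp add: be cs)
    then show "b = cos \<theta> *\<^sub>R ?u + sin \<theta> *\<^sub>R ?v"
      unfolding \<theta>(3,4) by (simp add: algebra_simps add_divide_distrib diff_divide_distrib)
    show "r\<^sub>1 = (cos \<theta> + sin \<theta>) / sqrt 2" "r\<^sub>2 = \<bar>cos \<theta> - sin \<theta>\<bar> / sqrt 2"
      using cs \<epsilon> r unfolding \<theta>(3,4) by (auto simp: abs_mult)
  qed
qed

section \<open>The join of the two Hodge spheres\<close>

definition join_points :: "real set \<Rightarrow> 'a bivector set" where
  "join_points T = {cos \<theta> *\<^sub>R u + sin \<theta> *\<^sub>R v | u v \<theta>. u \<in> S_plus \<omega> \<and> v \<in> S_minus \<omega> \<and> \<theta> \<in> T}"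

lemma nonempty_S: "S_plus \<omega> \<noteq> {}" "S_minus \<omega> \<noteq> {}"
  and compact_S: "compact_space (T_plus \<omega>)" "compact_space (T_minus \<omega>)"
  and homeomorphic_S2: "T_plus \<omega> homeomorphic_space S2" "T_minus \<omega> homeomorphic_space S2"
proof -
  obtain e where e: "e \<in> oriented_orthonormal_bases \<omega>"
    using oriented_frame_exists by blast
  note h = homeomorphic_map_hodge_eigenvector[OF e]
  have "(axis 1 1 :: real^3) \<in> sphere 0 1" by simp
  then show "S_plus \<omega> \<noteq> {}" "S_minus \<omega> \<noteq> {}"
    using homeomorphic_imp_surjective_map[OF h(1)] homeomorphic_imp_surjective_map[OF h(2)] by auto
  show hs: "T_plus \<omega> homeomorphic_space S2" "T_minus \<omega> homeomorphic_space S2"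
    using h by (metis homeomorphic_map_imp_homeomorphic_space homeomorphic_space_sym)+
  have "compact_space S2"
    by (simp add: compact_space_subtopology)
  then show "compact_space (T_plus \<omega>)" "compact_space (T_minus \<omega>)"
    using homeomorphic_compact_space[OF hs(1)] homeomorphic_compact_space[OF hs(2)] by auto
qed

lemma \<Phi>_eq_join_lift: "\<Phi> = join_lift (\<lambda>(u, v, \<theta>). cos \<theta> *\<^sub>R u + sin \<theta> *\<^sub>R v)"
  by (simp add: fun_eq_iff \<Phi>_def join_lift_def)

lemma \<Phi>_class:
  assumes "u \<in> S_plus \<omega>" "v \<in> S_minus \<omega>" "\<theta> \<in> {0..pi / 2}"
  shows "\<Phi> (hodge_class \<omega> (u, v, \<theta>)) = cos \<theta> *\<^sub>R u + sin \<theta> *\<^sub>R v"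
  unfolding \<Phi>_eq_join_lift
proof (subst join_lift_class)
  fix p q assume "(p, q) \<in> join_rel (T_plus \<omega>) (T_minus \<omega>)"
  then obtain u v u' v' t where "p = (u, v, t)" "q = (u', v', t)" "u = u' \<or> t = pi / 2" "v = v' \<or> t = 0"
    by (auto simp: join_rel_def)
  then show "(case p of (u, v, \<theta>) \<Rightarrow> cos \<theta> *\<^sub>R u + sin \<theta> *\<^sub>R v) =
      (case q of (u, v, \<theta>) \<Rightarrow> cos \<theta> *\<^sub>R u + sin \<theta> *\<^sub>R v)"
    by (cases "t = pi / 2") (auto simp del: divide_eq_eq_numeral1 eq_divide_eq_numeral1)
qed (use assms in auto)

lemma homeomorphic_map_\<Phi>: "homeomorphic_map (hodge_join \<omega>) (top_of_set (sphere 0 1)) \<Phi>"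
  unfolding \<Phi>_eq_join_lift
proof (rule homeomorphic_map_join_orthogonal_spheres[OF subspace_selfdual subspace_antiselfdual
      selfdual_orthogonal_antiselfdual hodge_decomposition])
  show "homeomorphic_map (T_plus \<omega>) (top_of_set (selfdual \<omega> \<inter> sphere 0 1)) (\<lambda>u. u)"
    "homeomorphic_map (T_minus \<omega>) (top_of_set (antiselfdual \<omega> \<inter> sphere 0 1)) (\<lambda>v. v)"
    by (simp_all add: S_plus_def S_minus_def Int_commute flip: id_def)
qed (use compact_S nonempty_S in simp_all)

lemma sphere_homeomorphic_join:
  "top_of_set (sphere (0 :: 'a bivector) 1) homeomorphic_space join_topology S2 S2"
proof -
  obtain e where e: "e \<in> oriented_orthonormal_bases \<omega>"
    using oriented_frame_exists by blast
  have "topspace S2 \<noteq> {}" "compact_space S2"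
    by (simp_all add: compact_space_subtopology)
  then have "\<exists>h. homeomorphic_map (join_topology S2 S2) (top_of_set (sphere (0 :: 'a bivector) 1)) h"
    using homeomorphic_map_join_orthogonal_spheres[OF subspace_selfdual subspace_antiselfdual
        selfdual_orthogonal_antiselfdual hodge_decomposition] homeomorphic_map_hodge_eigenvector[OF e]
    unfolding S_plus_def S_minus_def Int_commute[of "sphere 0 1"] by blast
  then show ?thesis
    by (meson homeomorphic_map_imp_homeomorphic_space homeomorphic_space_sym)
qed

lemma \<Phi>_part:
  assumes "T \<subseteq> {0..pi / 2}"
  shows "\<Phi> ` hodge_part \<omega> T = join_points T"
proof -
  have "\<Phi> ` hodge_part \<omega> T = (\<lambda>(u, v, \<theta>). cos \<theta> *\<^sub>R u + sin \<theta> *\<^sub>R v) ` (S_plus \<omega> \<times> S_minus \<omega> \<times> T)"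
    unfolding join_part_def image_image using assms
    by (intro image_cong) (auto intro!: \<Phi>_class)
  then show ?thesis
    by (force simp: join_points_def)
qed

lemma sphere_eq_join_points: "sphere 0 1 = join_points {0..pi / 2}"
proof -
  have "topspace (hodge_join \<omega>) = hodge_part \<omega> {0..pi / 2}"
    by (simp add: topspace_join_topology join_part_def)
  then show ?thesis
    using homeomorphic_imp_surjective_map[OF homeomorphic_map_\<Phi>] \<Phi>_part[of "{0..pi / 2}"] by simp
qed

text \<open>
  A condition on the singular values of a unit bivector becomes a condition on \<open>\<theta>\<close>; each stratum of
  the classification is an instance.
\<close>

lemma singular_value_locus:
  assumes T: "T \<subseteq> {0..pi / 2}"
    and P: "\<And>\<theta>. \<theta> \<in> {0..pi / 2} \<Longrightarrow>
      P ((cos \<theta> + sin \<theta>) / sqrt 2) (\<bar>cos \<theta> - sin \<theta>\<bar> / sqrt 2) \<longleftrightarrow> \<theta> \<in> T"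
  shows "{b \<in> sphere 0 1. \<exists>r\<^sub>1 r\<^sub>2. P r\<^sub>1 r\<^sub>2 \<and> singular_values \<omega> b r\<^sub>1 r\<^sub>2} = \<Phi> ` hodge_part \<omega> T"
  unfolding \<Phi>_part[OF T]
proof (intro equalityI subsetI)
  fix b assume "b \<in> {b \<in> sphere 0 1. \<exists>r\<^sub>1 r\<^sub>2. P r\<^sub>1 r\<^sub>2 \<and> singular_values \<omega> b r\<^sub>1 r\<^sub>2}"
  then obtain r\<^sub>1 r\<^sub>2 where b: "norm b = 1" "P r\<^sub>1 r\<^sub>2" "singular_values \<omega> b r\<^sub>1 r\<^sub>2" by auto
  from b(3,1) obtain u v \<theta> where *: "u \<in> S_plus \<omega>" "v \<in> S_minus \<omega>" "\<theta> \<in> {0..pi / 2}"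
    "b = cos \<theta> *\<^sub>R u + sin \<theta> *\<^sub>R v"
    "r\<^sub>1 = (cos \<theta> + sin \<theta>) / sqrt 2" "r\<^sub>2 = \<bar>cos \<theta> - sin \<theta>\<bar> / sqrt 2"
    by (rule join_of_singular_values)
  with b(2) P[of \<theta>] show "b \<in> join_points T"
    unfolding join_points_def by blast
next
  fix b assume "b \<in> join_points T"
  then obtain u v \<theta> where *: "u \<in> S_plus \<omega>" "v \<in> S_minus \<omega>" "\<theta> \<in> T" "b = cos \<theta> *\<^sub>R u + sin \<theta> *\<^sub>R v"
    unfolding join_points_def by blast
  with T have \<theta>: "\<theta> \<in> {0..pi / 2}" by blast
  have "b \<in> sphere 0 1"
    unfolding sphere_eq_join_points join_points_def using * \<theta> by blast
  moreover have "P ((cos \<theta> + sin \<theta>) / sqrt 2) (\<bar>cos \<theta> - sin \<theta>\<bar> / sqrt 2)"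
    using P[OF \<theta>] *(3) by blast
  ultimately show "b \<in> {b \<in> sphere 0 1. \<exists>r\<^sub>1 r\<^sub>2. P r\<^sub>1 r\<^sub>2 \<and> singular_values \<omega> b r\<^sub>1 r\<^sub>2}"
    using singular_values_join[OF *(1,2) \<theta>] *(4) by blast
qed

lemma sum_cos_sin_pos:
  assumes "\<theta> \<in> {0..pi / 2}"
  shows "cos \<theta> + sin \<theta> > 0"
proof -
  have "\<not> (\<theta> = pi / 2 \<and> \<theta> = 0)" by auto
  then show ?thesis
    using cos_sin_quarter_circle[OF assms] by linarith
qed

lemma rank_two_singular_locus:
  "{b \<in> sphere 0 1. \<exists>r\<^sub>1>0. singular_values \<omega> b r\<^sub>1 0} = \<Phi> ` hodge_part \<omega> {pi / 4}"
proof -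
  have "{b \<in> sphere 0 1. \<exists>r\<^sub>1>0. singular_values \<omega> b r\<^sub>1 0} =
      {b \<in> sphere 0 1. \<exists>r\<^sub>1 r\<^sub>2. (r\<^sub>1 > 0 \<and> r\<^sub>2 = 0) \<and> singular_values \<omega> b r\<^sub>1 r\<^sub>2}"
    by auto
  also have "\<dots> = \<Phi> ` hodge_part \<omega> {pi / 4}"
  proof (rule singular_value_locus)
    fix \<theta> :: real assume "\<theta> \<in> {0..pi / 2}"
    then show "0 < (cos \<theta> + sin \<theta>) / sqrt 2 \<and> \<bar>cos \<theta> - sin \<theta>\<bar> / sqrt 2 = 0 \<longleftrightarrow> \<theta> \<in> {pi / 4}"
      using sum_cos_sin_pos[of \<theta>] sin_eq_cos_iff[of \<theta>] by auto
  qed simp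
  finally show ?thesis .
qed

lemma equal_singular_locus:
  "{b \<in> sphere 0 1. \<exists>r>0. singular_values \<omega> b r r} = \<Phi> ` hodge_part \<omega> {0, pi / 2}"
proof -
  have "{b \<in> sphere 0 1. \<exists>r>0. singular_values \<omega> b r r} =
      {b \<in> sphere 0 1. \<exists>r\<^sub>1 r\<^sub>2. (r\<^sub>1 = r\<^sub>2 \<and> r\<^sub>2 > 0) \<and> singular_values \<omega> b r\<^sub>1 r\<^sub>2}"
    by auto
  also have "\<dots> = \<Phi> ` hodge_part \<omega> {0, pi / 2}"
  proof (rule singular_value_locus)
    fix \<theta> :: real assume \<theta>: "\<theta> \<in> {0..pi / 2}"
    then show "(cos \<theta> + sin \<theta>) / sqrt 2 = \<bar>cos \<theta> - sin \<theta>\<bar> / sqrt 2 \<and> 0 < \<bar>cos \<theta> - sin \<theta>\<bar> / sqrt 2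
        \<longleftrightarrow> \<theta> \<in> {0, pi / 2}"
      using sum_cos_sin_pos[OF \<theta>] cos_sin_quarter_circle[OF \<theta>] by (auto simp: abs_if split: if_splits)
  qed auto
  finally show ?thesis .
qed

lemma distinct_singular_locus:
  "{b \<in> sphere 0 1. \<exists>r\<^sub>1 r\<^sub>2. r\<^sub>1 > r\<^sub>2 \<and> r\<^sub>2 > 0 \<and> singular_values \<omega> b r\<^sub>1 r\<^sub>2} =
    \<Phi> ` hodge_part \<omega> ({0<..<pi / 4} \<union> {pi / 4<..<pi / 2})"
proof -
  have "{b \<in> sphere 0 1. \<exists>r\<^sub>1 r\<^sub>2. r\<^sub>1 > r\<^sub>2 \<and> r\<^sub>2 > 0 \<and> singular_values \<omega> b r\<^sub>1 r\<^sub>2} =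
      {b \<in> sphere 0 1. \<exists>r\<^sub>1 r\<^sub>2. (r\<^sub>1 > r\<^sub>2 \<and> r\<^sub>2 > 0) \<and> singular_values \<omega> b r\<^sub>1 r\<^sub>2}"
    by auto
  also have "\<dots> = \<Phi> ` hodge_part \<omega> ({0<..<pi / 4} \<union> {pi / 4<..<pi / 2})"
  proof (rule singular_value_locus)
    fix \<theta> :: real assume \<theta>: "\<theta> \<in> {0..pi / 2}"
    have "(cos \<theta> + sin \<theta>) / sqrt 2 > \<bar>cos \<theta> - sin \<theta>\<bar> / sqrt 2 \<longleftrightarrow> cos \<theta> \<noteq> 0 \<and> sin \<theta> \<noteq> 0"
      using cos_sin_quarter_circle(3,4)[OF \<theta>] by (auto simp: divide_less_cancel abs_if)
    moreover have "0 < \<bar>cos \<theta> - sin \<theta>\<bar> / sqrt 2 \<longleftrightarrow> \<theta> \<noteq> pi / 4"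
      using sin_eq_cos_iff[OF \<theta>] by auto
    ultimately show "\<bar>cos \<theta> - sin \<theta>\<bar> / sqrt 2 < (cos \<theta> + sin \<theta>) / sqrt 2 \<and> 0 < \<bar>cos \<theta> - sin \<theta>\<bar> / sqrt 2
        \<longleftrightarrow> \<theta> \<in> {0<..<pi / 4} \<union> {pi / 4<..<pi / 2}"
      using cos_sin_quarter_circle(1,2)[OF \<theta>] \<theta> by auto
  qed (use pi_gt_zero in auto)
  finally show ?thesis .
qed

lemma unit_bivector_normal_form:
  assumes "norm b = 1"
  obtains e r t where "e \<in> oriented_orthonormal_bases \<omega>" "r > 0"
    "b = r *\<^sub>R (e $ 1 \<and>\<^sub>V e $ 2) + t *\<^sub>R (e $ 3 \<and>\<^sub>V e $ 4)" "t = 0 \<Longrightarrow> singular_values \<omega> b r 0"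
proof -
  have "b \<in> join_points {0..pi / 2}"
    using assms unfolding sphere_eq_join_points[symmetric] by simp
  then obtain u v \<theta> where *: "u \<in> S_plus \<omega>" "v \<in> S_minus \<omega>" "\<theta> \<in> {0..pi / 2}"
      "b = cos \<theta> *\<^sub>R u + sin \<theta> *\<^sub>R v"
    unfolding join_points_def by blast
  let ?r = "(cos \<theta> + sin \<theta>) / sqrt 2"
  have sv: "singular_values \<omega> b ?r (\<bar>cos \<theta> - sin \<theta>\<bar> / sqrt 2)"
    using singular_values_join[OF *(1-3)] *(4) by simp
  then obtain e \<epsilon> where e: "e \<in> oriented_orthonormal_bases \<omega>" "\<epsilon> = 1 \<or> \<epsilon> = -1"
    "b = ?r *\<^sub>R (e $ 1 \<and>\<^sub>V e $ 2) + (\<epsilon> * (\<bar>cos \<theta> - sin \<theta>\<bar> / sqrt 2)) *\<^sub>R (e $ 3 \<and>\<^sub>V e $ 4)"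
    unfolding singular_values_def by blast
  show ?thesis
  proof
    show "?r > 0"
      using sum_cos_sin_pos[OF *(3)] by simp
    show "singular_values \<omega> b ?r 0" if "\<epsilon> * (\<bar>cos \<theta> - sin \<theta>\<bar> / sqrt 2) = 0"
      using sv that e(2) by auto
  qed (fact e)+
qed

lemma rank_two_iff:
  assumes "norm b = 1"
  shows "bivector_rank b = 2 \<longleftrightarrow> (\<exists>r>0. singular_values \<omega> b r 0)"
proof
  assume rank: "bivector_rank b = 2"
  obtain e r t where e: "e \<in> oriented_orthonormal_bases \<omega>" "r > 0"
    "b = r *\<^sub>R (e $ 1 \<and>\<^sub>V e $ 2) + t *\<^sub>R (e $ 3 \<and>\<^sub>V e $ 4)" "t = 0 \<Longrightarrow> singular_values \<omega> b r 0"
    using unit_bivector_normal_form[OF assms] by metis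
  with rank bivector_rank_normal_form[OF orthonormal_of_oriented[OF e(1)] dim4, of r t]
  show "\<exists>r>0. singular_values \<omega> b r 0"
    by auto
next
  assume "\<exists>r>0. singular_values \<omega> b r 0"
  then obtain r e where "r > 0" "e \<in> oriented_orthonormal_bases \<omega>" "b = r *\<^sub>R (e $ 1 \<and>\<^sub>V e $ 2)"
    by (auto simp: singular_values_def)
  then show "bivector_rank b = 2"
    using bivector_rank_normal_form[OF orthonormal_of_oriented dim4, of e r 0] by simp
qed

lemma simple_iff: "simple_bivector b \<longleftrightarrow> (\<exists>r>0. singular_values \<omega> b r 0)"
proof
  assume "simple_bivector b"
  then obtain x y where xy: "b = x \<and>\<^sub>V y" "x \<and>\<^sub>V y \<noteq> 0"
    by (auto simp: simple_bivector_def)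
  obtain e where "e \<in> oriented_orthonormal_bases \<omega>" "x \<and>\<^sub>V y = norm (x \<and>\<^sub>V y) *\<^sub>R (e $ 1 \<and>\<^sub>V e $ 2)"
    by (rule wedge_normal_form[OF xy(2)])
  with xy show "\<exists>r>0. singular_values \<omega> b r 0"
    by (intro exI[of _ "norm b"]) (auto simp: singular_values_def)
next
  assume "\<exists>r>0. singular_values \<omega> b r 0"
  then obtain r e where r: "r > 0" "e \<in> oriented_orthonormal_bases \<omega>" "b = r *\<^sub>R (e $ 1 \<and>\<^sub>V e $ 2)"
    by (auto simp: singular_values_def)
  have "(e $ 1 \<and>\<^sub>V e $ 2) \<bullet> (e $ 1 \<and>\<^sub>V e $ 2) = 1"
    using orthonormal_of_oriented[OF r(2)] by (simp add: inner_wedge orthonormal_def)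
  then have "b \<noteq> 0"
    using r by auto
  moreover have "b = (r *\<^sub>R e $ 1) \<and>\<^sub>V e $ 2"
    by (simp add: r(3) wedge_linear)
  ultimately show "simple_bivector b"
    by (auto simp: simple_bivector_def)
qed

lemma Hausdorff_hodge_join: "Hausdorff_space (hodge_join \<omega>)"
  using homeomorphic_Hausdorff_space[OF homeomorphic_map_imp_homeomorphic_space[OF homeomorphic_map_\<Phi>]]
  by (simp add: Hausdorff_space_subtopology)

lemma join_action_class:
  assumes g: "g \<in> SO \<omega>" and "u \<in> S_plus \<omega>" "v \<in> S_minus \<omega>" "\<theta> \<in> {0..pi / 2}"
  shows "SO_join_action \<omega> g (hodge_class \<omega> (u, v, \<theta>)) = hodge_class \<omega> (bivector_map g u, bivector_map g v, \<theta>)"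
  using assms hodge_spheres_invariant[OF g] by (intro join_map_class) auto

lemma \<Phi>_equivariant:
  assumes g: "g \<in> SO \<omega>" and C: "C \<in> topspace (hodge_join \<omega>)"
  shows "\<Phi> (SO_join_action \<omega> g C) = bivector_map g (\<Phi> C)"
proof -
  obtain u v \<theta> where *: "u \<in> S_plus \<omega>" "v \<in> S_minus \<omega>" "\<theta> \<in> {0..pi / 2}" "C = hodge_class \<omega> (u, v, \<theta>)"
    using C by (auto simp: topspace_join_topology)
  have "linear (bivector_map g)"
    using g by (intro bivector_map_linear) (simp add: SO_def orthogonal_transformation_def)
  then show ?thesis
    using * hodge_spheres_invariant[OF g] by (simp add: join_action_class[OF g] \<Phi>_class linear_add linear_scale)
qed

lemma midpoint_homeomorphism:
  "homeomorphic_map (prod_topology (T_plus \<omega>) (T_minus \<omega>))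
    (subtopology (hodge_join \<omega>) (hodge_part \<omega> {pi / 4})) (\<lambda>(u, v). hodge_class \<omega> (u, v, pi / 4))"
proof -
  have "homeomorphic_map (prod_topology (T_plus \<omega>) (T_minus \<omega>))
      (prod_topology (T_plus \<omega>) (prod_topology (T_minus \<omega>) (top_of_set {pi / 4}))) (\<lambda>(u, v). (u, v, pi / 4))"
    unfolding homeomorphic_map_maps
    by (rule exI[of _ "\<lambda>(u, v, \<theta>). (u, v)"])
      (auto simp: homeomorphic_maps_def continuous_map_pairwise o_def case_prod_beta
        intro!: continuous_intros)
  from homeomorphic_map_compose[OF this homeomorphic_map_join_part[of "{pi / 4}"]]
  show ?thesis
    by (simp add: o_def case_prod_unfold)
qed

lemma ends_homeomorphism:
  assumes "u\<^sub>0 \<in> S_plus \<omega>" "v\<^sub>0 \<in> S_minus \<omega>"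
  shows "homeomorphic_map (sum_topology (\<lambda>i::bool. if i then T_plus \<omega> else T_minus \<omega>) UNIV)
    (subtopology (hodge_join \<omega>) (hodge_part \<omega> {0, pi / 2}))
    (\<lambda>(i, w). hodge_class \<omega> (if i then (w, v\<^sub>0, 0) else (u\<^sub>0, w, pi / 2)))"
proof -
  let ?T = "\<lambda>i::bool. if i then {0} else {pi / 2}"
  have U: "(\<Union>i\<in>UNIV. hodge_part \<omega> (?T i)) = hodge_part \<omega> {0, pi / 2}"
    using join_part_Un[of "T_plus \<omega>" "T_minus \<omega>" "{0}" "{pi / 2}"] by (simp add: UNIV_bool insert_commute Un_commute)
  show ?thesis
    unfolding U[symmetric]
  proof (rule homeomorphic_map_sum_topology)
    show "homeomorphic_map (if i then T_plus \<omega> else T_minus \<omega>)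
        (subtopology (hodge_join \<omega>) (hodge_part \<omega> (?T i)))
        (\<lambda>w. hodge_class \<omega> (if i then (w, v\<^sub>0, 0) else (u\<^sub>0, w, pi / 2)))" for i
      using homeomorphic_map_join_ends[OF Hausdorff_hodge_join] compact_S assms by auto
    have "{0} = {0, pi / 2} \<inter> {..<1}" "{pi / 2} = {0, pi / 2} \<inter> {1<..}"
      using pi_half_gt_zero pi_gt3 by (auto simp del: pi_half_gt_zero)
    then have "openin (top_of_set {0, pi / 2}) {0}" "openin (top_of_set {0, pi / 2}) {pi / 2}"
      by (metis openin_open_Int open_lessThan open_greaterThan)+
    then show "openin (subtopology (hodge_join \<omega>) (\<Union>i\<in>UNIV. hodge_part \<omega> (?T i))) (hodge_part \<omega> (?T i))" for i
      unfolding U by (auto intro!: openin_join_part_within)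
    show "disjoint_family_on (\<lambda>i. hodge_part \<omega> (?T i)) UNIV"
      using join_part_Int[of "{0}" "{pi / 2}" "T_plus \<omega>" "T_minus \<omega>"]
      by (auto simp: disjoint_family_on_def join_part_def[of _ _ "{}"])
  qed
qed

lemma chambers_homeomorphism:
  "homeomorphic_map
    (sum_topology (\<lambda>i::bool. prod_topology (T_plus \<omega>) (prod_topology (T_minus \<omega>)
      (top_of_set (if i then {0<..<pi / 4} else {pi / 4<..<pi / 2})))) UNIV)
    (subtopology (hodge_join \<omega>) (hodge_part \<omega> ({0<..<pi / 4} \<union> {pi / 4<..<pi / 2})))
    (\<lambda>(i, p). hodge_class \<omega> p)"
proof -
  let ?T = "\<lambda>i::bool. if i then {0<..<pi / 4} else {pi / 4<..<pi / 2}"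
  let ?U = "{0<..<pi / 4} \<union> {pi / 4<..<pi / 2}"
  have T: "open (?T i)" "?T i \<subseteq> {0<..<pi / 2}" "?T i \<subseteq> {0..pi / 2}" "?T i \<subseteq> ?U" for i
    by auto
  have U: "(\<Union>i\<in>UNIV. hodge_part \<omega> (?T i)) = hodge_part \<omega> ?U"
    by (simp add: UNIV_bool join_part_Un Un_commute)
  show ?thesis
    unfolding U[symmetric]
  proof (rule homeomorphic_map_sum_topology)
    show "homeomorphic_map (prod_topology (T_plus \<omega>) (prod_topology (T_minus \<omega>) (top_of_set (?T i))))
        (subtopology (hodge_join \<omega>) (hodge_part \<omega> (?T i))) (hodge_class \<omega>)" for i
      by (rule homeomorphic_map_join_part[OF disjI1[OF open_subset[OF T(3,1)]] T(2)])
    have "?U \<subseteq> {0..pi / 2}" by auto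
    from openin_join_part_within[OF open_subset[OF T(4,1)] this]
    show "openin (subtopology (hodge_join \<omega>) (\<Union>i\<in>UNIV. hodge_part \<omega> (?T i))) (hodge_part \<omega> (?T i))" for i
      unfolding U .
    have "hodge_part \<omega> (?T i) \<inter> hodge_part \<omega> (?T j) = {}" if "i \<noteq> j" for i j
    proof -
      have "?T i \<inter> ?T j = {}"
        using that by auto
      then show ?thesis
        using join_part_Int[OF T(3)[of i] T(3)[of j], of "T_plus \<omega>" "T_minus \<omega>"] by (simp add: join_part_def)
    qed
    then show "disjoint_family_on (\<lambda>i. hodge_part \<omega> (?T i)) UNIV"
      by (simp add: disjoint_family_on_def)
  qed
qed

lemma \<Phi>_ends:
  "\<Phi> ` hodge_part \<omega> {0} = S_plus \<omega>" "\<Phi> ` hodge_part \<omega> {pi / 2} = S_minus \<omega>"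
proof -
  have "join_points T = (\<Union>\<theta>\<in>T. {cos \<theta> *\<^sub>R u + sin \<theta> *\<^sub>R v | u v. u \<in> S_plus \<omega> \<and> v \<in> S_minus \<omega>})" for T
    unfolding join_points_def by blast
  then have "join_points {0} = S_plus \<omega>" "join_points {pi / 2} = S_minus \<omega>"
    using nonempty_S by auto
  then show "\<Phi> ` hodge_part \<omega> {0} = S_plus \<omega>" "\<Phi> ` hodge_part \<omega> {pi / 2} = S_minus \<omega>"
    by (simp_all add: \<Phi>_part)
qed

end

lemma orientations_nonempty: "(orientations :: ((real ^ 'n) ^ 'n) set set) \<noteq> {}"
proof -
  have "orthonormal ((\<chi> i. axis i 1) :: (real ^ 'n) ^ 'n)"
    by (simp add: orthonormal_def inner_axis_axis)
  then have "((\<chi> i. axis i 1) :: (real ^ 'n) ^ 'n) \<in> ordered_bases"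
    by (rule orthonormal_imp_ordered_basis) simp
  then show ?thesis
    unfolding orientations_def by (auto simp: quotient_def)
qed

theorem theorem15p1:
  fixes \<omega> :: "('a::euclidean_space ^ 4) set"
  assumes dim4: "DIM('a) = 4"
    and orientation: "\<omega> \<in> orientations"
  shows "
    \<comment> \<open>\<open>S\<^sub>+\<close> and \<open>S\<^sub>-\<close> are two-spheres\<close>
    (T_plus \<omega> homeomorphic_space S2 \<and> T_minus \<omega> homeomorphic_space S2)
    \<and>
    \<comment> \<open>\<open>\<Phi>\<close> is well defined, a homeomorphism and equivariant\<close>
    (\<forall>u\<in>S_plus \<omega>. \<forall>v\<in>S_minus \<omega>. \<forall>\<theta>\<in>{0..pi / 2}.
      \<Phi> (hodge_class \<omega> (u, v, \<theta>)) = cos \<theta> *\<^sub>R u + sin \<theta> *\<^sub>R v) \<and>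
    homeomorphic_map (hodge_join \<omega>) (top_of_set (sphere 0 1)) \<Phi> \<and>
    (\<forall>g\<in>SO \<omega>. \<forall>u\<in>S_plus \<omega>. \<forall>v\<in>S_minus \<omega>. \<forall>\<theta>\<in>{0..pi / 2}.
      bivector_map g u \<in> S_plus \<omega> \<and> bivector_map g v \<in> S_minus \<omega> \<and>
      SO_join_action \<omega> g (hodge_class \<omega> (u, v, \<theta>)) =
        hodge_class \<omega> (bivector_map g u, bivector_map g v, \<theta>)) \<and>
    (\<forall>g\<in>SO \<omega>. \<forall>C\<in>topspace (hodge_join \<omega>).
      \<Phi> (SO_join_action \<omega> g C) = bivector_map g (\<Phi> C))
    \<and>
    \<comment> \<open>the case of Euclidean four-space\<close>
    top_of_set (sphere (0 :: (real ^ 4) bivector) 1) homeomorphic_space join_topology S2 S2 \<and>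
    join_topology S2 S2 homeomorphic_space S5
    \<and>
    \<comment> \<open>(i)\<close>
    {b \<in> sphere 0 1. bivector_rank b = 2} = \<Phi> ` hodge_part \<omega> {pi / 4} \<and>
    {b \<in> sphere 0 1. simple_bivector b} = \<Phi> ` hodge_part \<omega> {pi / 4} \<and>
    {b \<in> sphere 0 1. \<exists>r\<^sub>1>0. singular_values \<omega> b r\<^sub>1 0} = \<Phi> ` hodge_part \<omega> {pi / 4} \<and>
    homeomorphic_map (prod_topology (T_plus \<omega>) (T_minus \<omega>))
      (subtopology (hodge_join \<omega>) (hodge_part \<omega> {pi / 4}))
      (\<lambda>(u, v). hodge_class \<omega> (u, v, pi / 4)) \<and>
    prod_topology (T_plus \<omega>) (T_minus \<omega>) homeomorphic_space prod_topology S2 S2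
    \<and>
    \<comment> \<open>(ii)\<close>
    {b \<in> sphere 0 1. \<exists>r>0. singular_values \<omega> b r r} = \<Phi> ` hodge_part \<omega> {0, pi / 2} \<and>
    \<Phi> ` hodge_part \<omega> {0} = S_plus \<omega> \<and> \<Phi> ` hodge_part \<omega> {pi / 2} = S_minus \<omega> \<and>
    (\<forall>u\<^sub>0\<in>S_plus \<omega>. \<forall>v\<^sub>0\<in>S_minus \<omega>.
      homeomorphic_map (sum_topology (\<lambda>i::bool. if i then T_plus \<omega> else T_minus \<omega>) UNIV)
        (subtopology (hodge_join \<omega>) (hodge_part \<omega> {0, pi / 2}))
        (\<lambda>(i, w). hodge_class \<omega> (if i then (w, v\<^sub>0, 0) else (u\<^sub>0, w, pi / 2)))) \<and>
    sum_topology (\<lambda>i::bool. if i then T_plus \<omega> else T_minus \<omega>) UNIV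
      homeomorphic_space sum_topology (\<lambda>i::bool. S2) UNIV
    \<and>
    \<comment> \<open>(iii)\<close>
    {b \<in> sphere 0 1. \<exists>r\<^sub>1 r\<^sub>2. r\<^sub>1 > r\<^sub>2 \<and> r\<^sub>2 > 0 \<and> singular_values \<omega> b r\<^sub>1 r\<^sub>2} =
      \<Phi> ` hodge_part \<omega> ({0<..<pi / 4} \<union> {pi / 4<..<pi / 2}) \<and>
    homeomorphic_map
      (sum_topology (\<lambda>i::bool. prod_topology (T_plus \<omega>) (prod_topology (T_minus \<omega>)
        (top_of_set (if i then {0<..<pi / 4} else {pi / 4<..<pi / 2})))) UNIV)
      (subtopology (hodge_join \<omega>) (hodge_part \<omega> ({0<..<pi / 4} \<union> {pi / 4<..<pi / 2})))
      (\<lambda>(i, p). hodge_class \<omega> p) \<and>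
    sum_topology (\<lambda>i::bool. prod_topology (T_plus \<omega>) (prod_topology (T_minus \<omega>)
        (top_of_set (if i then {0<..<pi / 4} else {pi / 4<..<pi / 2})))) UNIV
      homeomorphic_space
    sum_topology (\<lambda>i::bool. prod_topology S2 (prod_topology S2
        (top_of_set (if i then {0<..<pi / 4} else {pi / 4<..<pi / 2})))) UNIV"
proof -
  interpret oriented_four_space \<omega>
    using dim4 orientation by unfold_locales
  \<comment> \<open>The statement about \<open>\<Lambda>\<^sup>2\<real>\<^sup>4\<close> involves no orientation, but its Hodge decomposition needs a choice.\<close>
  obtain \<omega>' :: "((real ^ 4) ^ 4) set" where "\<omega>' \<in> orientations"
    using orientations_nonempty by blast
  then interpret R4: oriented_four_space \<omega>'
    by unfold_locales simp_all
  have rank: "{b \<in> sphere 0 1. bivector_rank b = 2} = \<Phi> ` hodge_part \<omega> {pi / 4}"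
    unfolding rank_two_singular_locus[symmetric] using rank_two_iff by auto
  have simple: "{b \<in> sphere 0 1. simple_bivector b} = \<Phi> ` hodge_part \<omega> {pi / 4}"
    unfolding rank_two_singular_locus[symmetric] simple_iff ..
  have "(if i then T_plus \<omega> else T_minus \<omega>) homeomorphic_space S2" for i
    using homeomorphic_S2 by simp
  then have ends: "sum_topology (\<lambda>i::bool. if i then T_plus \<omega> else T_minus \<omega>) UNIV
      homeomorphic_space sum_topology (\<lambda>i::bool. S2) UNIV"
    by (rule homeomorphic_space_sum_topology)
  have chambers: "sum_topology (\<lambda>i::bool. prod_topology (T_plus \<omega>) (prod_topology (T_minus \<omega>)
        (top_of_set (if i then {0<..<pi / 4} else {pi / 4<..<pi / 2})))) UNIV
      homeomorphic_space
    sum_topology (\<lambda>i::bool. prod_topology S2 (prod_topology S2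
        (top_of_set (if i then {0<..<pi / 4} else {pi / 4<..<pi / 2})))) UNIV"
    by (intro homeomorphic_space_sum_topology homeomorphic_space_prod_topology homeomorphic_S2
        homeomorphic_space_refl)
  show ?thesis
    by (intro conjI ballI homeomorphic_S2 \<Phi>_class homeomorphic_map_\<Phi> hodge_spheres_invariant join_action_class
        \<Phi>_equivariant R4.sphere_homeomorphic_join sphere_join_homeomorphic_S5 rank simple
        rank_two_singular_locus midpoint_homeomorphism homeomorphic_space_prod_topology
        equal_singular_locus \<Phi>_ends ends_homeomorphism ends distinct_singular_locus
        chambers_homeomorphism chambers)
qed

end
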